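(* Let $G$ be a finite nontrivial nilpotent group none of whose Sylow subgroups is cyclic or generalized quaternion. (a) If $G$ is a $p$-group for a prime $p$, having exactly $r$ distinct subgroups of order $p$, and $\mathcal{G}_E^{**}(G)$ has a total dominating set, then $\gamma^{\text{strong}}(\mathcal{G}_E^{**}(G))=2r$. (b) If $G=P_1\times\cdots\times P_m$ with $m\geq 2$, where $P_1,\dots,P_m$ are the Sylow subgroups of $G$ for the distinct prime divisors $p_1,\dots,p_m$ of $|G|$ and $r_i$ is the number of distinct subgroups of order $p_i$ in $P_i$, then $\gamma^{\text{strong}}(\mathcal{G}_E^{**}(G))=\left(\min_{1\leq i\leq m} r_i\right)+1$.
   Context: The enhanced power graph $\mathcal{G}_E(G)$ of a group $G$ is the simple graph with vertex set $G$ in which two distinct vertices $u,v$ are adjacent if and only if there is $w\in G$ with $u\in\langle w\rangle$ and $v\in\langle w\rangle$. A dominating vertex of a graph is a vertex adjacent to every other vertex. The proper enhanced power graph $\mathcal{G}_E^{**}(G)$ is the graph obtained from $\mathcal{G}_E(G)$ by deleting all of its dominating vertices (including the identity). A total dominating set (or strongly dominating set) of a graph $\Gamma=(V,E)$ is a set $D\subseteq V$ such that every vertex $u\in V$ (including those in $D$) is adjacent to some $v\in D$. The strong domination number $\gamma^{\text{strong}}(\Gamma)$ is the minimum cardinality of a total dominating set of $\Gamma$. The generalized quaternion group $Q_{2^k}$ ($k\geq 3$) is the group of order $2^k$ generated by $x,y$ with $x^{2^{k-1}}=1$, $x^{2^{k-2}}=y^2$ and $yxy^{-1}=x^{-1}$.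 *)

theory Defs
  imports
    "HOL-Algebra.Algebra"
    "HOL-Computational_Algebra.Primes"
    "HOL-Library.Extended_Nat"
    "Graph_Theory.Graph_Theory"
begin

primrec lower_central_series :: "('a, 'b) monoid_scheme \<Rightarrow> nat \<Rightarrow> 'a set" where
  "lower_central_series G 0 = carrier G"
| "lower_central_series G (Suc n) =
     generate G (\<Union>x \<in> lower_central_series G n. \<Union>y \<in> carrier G.
       {x \<otimes>\<^bsub>G\<^esub> y \<otimes>\<^bsub>G\<^esub> inv\<^bsub>G\<^esub> x \<otimes>\<^bsub>G\<^esub> inv\<^bsub>G\<^esub> y})"

definition nilpotent_group :: "('a, 'b) monoid_scheme \<Rightarrow> bool" where
  "nilpotent_group G \<longleftrightarrow> group G \<and> (\<exists>n. lower_central_series G n = {\<one>\<^bsub>G\<^esub>})"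

text \<open>For a prime \<open>p\<close> not dividing the order of \<open>G\<close> this yields the trivial subgroup, which is
  cyclic; statements about ``the Sylow subgroups'' should therefore be restricted to the
  prime divisors of the order.\<close>

definition sylow_subgroup :: "('a, 'b) monoid_scheme \<Rightarrow> nat \<Rightarrow> 'a set \<Rightarrow> bool" where
  "sylow_subgroup G p P \<longleftrightarrow>
     Factorial_Ring.prime p \<and> subgroup P G \<and> card P = p ^ multiplicity p (order G)"

definition generalized_quaternion_group :: "('a, 'b) monoid_scheme \<Rightarrow> bool" where
  "generalized_quaternion_group G \<longleftrightarrow> group G \<and>
     (\<exists>k\<ge>3. order G = 2 ^ k \<and>
       (\<exists>x \<in> carrier G. \<exists>y \<in> carrier G.
          generate G {x, y} = carrier G \<and>
          x [^]\<^bsub>G\<^esub> (2 ^ (k - 1) :: nat) = \<one>\<^bsub>G\<^esub> \<and>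
          x [^]\<^bsub>G\<^esub> (2 ^ (k - 2) :: nat) = y [^]\<^bsub>G\<^esub> (2 :: nat) \<and>
          y \<otimes>\<^bsub>G\<^esub> x \<otimes>\<^bsub>G\<^esub> inv\<^bsub>G\<^esub> y = inv\<^bsub>G\<^esub> x))"

definition num_subgroups_of_order :: "('a, 'b) monoid_scheme \<Rightarrow> nat \<Rightarrow> nat" where
  "num_subgroups_of_order G n = card {H. subgroup H G \<and> card H = n}"

text \<open>As in the locale \<^locale>\<open>graph\<close>, a simple graph is a loop-free symmetric digraph
  without parallel arcs; here the arcs are the ordered pairs of adjacent vertices.\<close>

definition enhanced_power_graph :: "('a, 'b) monoid_scheme \<Rightarrow> ('a, 'a \<times> 'a) pre_digraph" where
  "enhanced_power_graph G =
     \<lparr> verts = carrier G,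
       arcs = {(u, v). u \<in> carrier G \<and> v \<in> carrier G \<and> u \<noteq> v \<and>
                 (\<exists>w \<in> carrier G. u \<in> generate G {w} \<and> v \<in> generate G {w})},
       tail = fst, head = snd \<rparr>"

definition dominating_vertices :: "('a, 'b) pre_digraph \<Rightarrow> 'a set" where
  "dominating_vertices \<Gamma> = {v \<in> verts \<Gamma>. \<forall>u \<in> verts \<Gamma> - {v}. v \<rightarrow>\<^bsub>\<Gamma>\<^esub> u}"

definition proper_enhanced_power_graph ::
    "('a, 'b) monoid_scheme \<Rightarrow> ('a, 'a \<times> 'a) pre_digraph" where
  "proper_enhanced_power_graph G =
     enhanced_power_graph G \<restriction> (carrier G - dominating_vertices (enhanced_power_graph G))"

definition total_dominating_set :: "('a, 'b) pre_digraph \<Rightarrow> 'a set \<Rightarrow> bool" where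
  "total_dominating_set \<Gamma> D \<longleftrightarrow> D \<subseteq> verts \<Gamma> \<and> (\<forall>u \<in> verts \<Gamma>. \<exists>v \<in> D. u \<rightarrow>\<^bsub>\<Gamma>\<^esub> v)"

text \<open>The value is \<open>\<infinity>\<close> if there is no finite total dominating set, so an equation with a
  finite right-hand side includes the existence of a total dominating set.\<close>

definition strong_domination_number :: "('a, 'b) pre_digraph \<Rightarrow> enat" where
  "strong_domination_number \<Gamma> =
     (INF D \<in> {D. total_dominating_set \<Gamma> D \<and> finite D}. enat (card D))"

lemma graph_enhanced_power_graph:
  assumes "finite (carrier G)"
  shows "graph (enhanced_power_graph G)"
proof -
  have "finite (arcs (enhanced_power_graph G))"
    by (rule finite_subset[of _ "carrier G \<times> carrier G"])
      (use assms in \<open>auto simp: enhanced_power_graph_def\<close>)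
  then show ?thesis
    using assms
    by unfold_locales
      (auto simp: enhanced_power_graph_def arc_to_ends_def symmetric_conv)
qed

lemma (in group) one_in_dominating_vertices:
  "\<one> \<in> dominating_vertices (enhanced_power_graph G)"
proof -
  have "\<one> \<in> generate G {u} \<and> u \<in> generate G {u}" for u
    by (auto intro: generate.one generate.incl)
  then show ?thesis
    by (fastforce simp: dominating_vertices_def enhanced_power_graph_def arcs_ends_conv)
qed

end

theory Submission
  imports Defs "HOL-Number_Theory.Residues"
begin

text \<open>
  The hypothesis on the Sylow subgroups forces the identity to be the only dominating vertex: a
  dominating vertex of order divisible by \<open>p\<close> shares a cyclic subgroup with every element, so
  \<open>G\<close> has only one subgroup of order \<open>p\<close>, and a \<open>p\<close>-group with this property is cyclic or
  generalized quaternion. For the latter fact take \<open>x\<close> generating a largest cyclic normal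
  subgroup \<open>A\<close>; nilpotency makes \<open>A\<close> self-centralizing. An element \<open>y\<close> outside \<open>A\<close> with
  \<open>y\<^sup>p\<close> in \<open>A\<close> acts as \<open>x \<mapsto> x\<^sup>a\<close>, and unless \<open>p = 2\<close> and \<open>y\<close> inverts \<open>x\<close> some \<open>x\<^sup>i y\<close> has
  order \<open>p\<close>, which is impossible. As \<open>-1\<close> is not a square modulo \<open>4\<close>, \<open>A\<close> then has index \<open>2\<close>.

  Adjacent vertices of order divisible by \<open>p\<close> determine the same subgroup of order \<open>p\<close>. In a
  \<open>p\<close>-group a total dominating set therefore needs two elements for each such subgroup, and two
  suffice. In case (b) generators of the subgroups of order \<open>p\<^sub>i\<close>, with \<open>r\<^sub>i\<close> minimal, together
  with one element of another prime order form a total dominating set. Conversely, assign to each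
  \<open>d\<close> in a total dominating set \<open>D\<close> a prime divisor of its order. If \<open>|D|\<close> is at most every
  \<open>r\<^sub>i\<close>, then for every \<open>i\<close> some subgroup of order \<open>p\<^sub>i\<close> is not determined by any \<open>d\<close> assigned
  to \<open>p\<^sub>i\<close>, because \<open>D\<close> contains two adjacent elements; an element whose powers generate
  all these missed subgroups has no neighbour in \<open>D\<close>.
\<close>

section \<open>Groups of prime power order with a unique subgroup of prime order\<close>

text \<open>Write \<open>a = 1 + p * t\<close>. Modulo \<open>p * p\<close> the power
  \<open>a ^ l\<close> is \<open>1 + l * p * t\<close>, and for odd \<open>p\<close> the sum of all
  \<open>l < p\<close> is a multiple of \<open>p\<close>, so the sum of powers is \<open>p\<close>
  modulo \<open>p * p\<close>. For \<open>p = 2\<close> the congruence modulo 4 replaces this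
  argument. The sum appears as an exponent in the \<open>p\<close>-th power of
  \<open>x [^] i \<otimes> y\<close>; a single factor \<open>p\<close> in it makes it possible to
  solve for \<open>i\<close>.\<close>

lemma sum_powers_cong_one:
  fixes p a :: nat
  assumes p: "Factorial_Ring.prime p" and a: "[a = 1] (mod p)" "p = 2 \<Longrightarrow> [a = 1] (mod 4)"
  shows "\<exists>u. coprime u p \<and> (\<Sum>l<p. a ^ l) = p * u"
proof (cases "p = 2")
  case True
  then have "a mod 4 = 1" using a by (simp add: cong_def)
  then have "\<exists>t. a = 1 + 4 * t" by (metis add.commute mult.commute div_mult_mod_eq)
  then obtain t where t: "a = 1 + 4 * t" by blast
  have "(\<Sum>l<p. a ^ l) = p * (2 * t + 1)" using True t by (simp add: numeral_2_eq_2)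
  moreover have "coprime (2 * t + 1) p" using True by simp
  ultimately show ?thesis by blast
next
  case False
  have p1: "1 < p" using p by (rule prime_gt_1_nat)
  then have "a mod p = 1" using a(1) by (simp add: cong_def)
  then obtain t where t: "a = 1 + p * t" by (metis add.commute mult.commute div_mult_mod_eq)
  have pow: "\<exists>s. a ^ l = 1 + l * p * t + p * p * s" for l
  proof (induction l)
    case (Suc l)
    then obtain s where "a ^ l = 1 + l * p * t + p * p * s" by blast
    then have "a ^ Suc l = 1 + Suc l * p * t + p * p * (l * t * t + s + p * t * s)"
      by (simp add: t algebra_simps)
    then show ?case by blast
  qed (auto intro: exI[of _ 0])
  have sums: "\<exists>s. (\<Sum>l<k. a ^ l) = k + (\<Sum>l<k. l) * p * t + p * p * s" for k
  proof (induction k)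
    case (Suc k)
    then obtain s where s: "(\<Sum>l<k. a ^ l) = k + (\<Sum>l<k. l) * p * t + p * p * s" by blast
    obtain s' where "a ^ k = 1 + k * p * t + p * p * s'" using pow by blast
    then have "(\<Sum>l<Suc k. a ^ l) = Suc k + (\<Sum>l<Suc k. l) * p * t + p * p * (s + s')"
      using s by (simp add: algebra_simps)
    then show ?case by blast
  qed auto
  have "odd p" using p False primes_dvd_imp_eq two_is_prime_nat by blast
  then obtain h where h: "p = 2 * h + 1" by (elim oddE)
  have "(\<Sum>l<p. l) = p * h"
    using Sum_Ico_nat[of 0 p] h by (simp add: atLeast0LessThan)
  moreover obtain s where "(\<Sum>l<p. a ^ l) = p + (\<Sum>l<p. l) * p * t + p * p * s"
    using sums by blast
  ultimately have "(\<Sum>l<p. a ^ l) = p * (1 + p * (h * t + s))"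
    by (simp add: algebra_simps)
  moreover have "\<not> p dvd 1 + p * (h * t + s)"
    using p1 dvd_add_left_iff[of p "p * (h * t + s)" 1] by auto
  then have "coprime (1 + p * (h * t + s)) p"
    using p prime_imp_coprime coprime_commute by blast
  ultimately show ?thesis by blast
qed

lemma cong_one_of_prime_power:
  fixes p a :: nat
  assumes p: "Factorial_Ring.prime p" and a: "[a ^ p = 1] (mod p)"
  shows "[a = 1] (mod p)"
proof -
  have p1: "p > 1" using p by (rule prime_gt_1_nat)
  have "\<not> p dvd a"
  proof
    assume "p dvd a"
    moreover have "a dvd a ^ p" using p1 by (intro dvd_power) simp
    ultimately have "p dvd a ^ p" by (rule dvd_trans)
    then have "[a ^ p = 0] (mod p)" by (rule cong_0_iff[THEN iffD2])
    then have "[1 = 0] (mod p)" by (rule cong_trans[OF cong_sym[OF a]])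
    then have "p dvd 1" by (rule cong_0_iff[THEN iffD1])
    then show False using p1 by simp
  qed
  with p have "[a ^ (p - 1) = 1] (mod p)" by (rule fermat_theorem)
  then have "[a ^ (p - 1) * a = 1 * a] (mod p)" by (rule cong_scalar_right)
  moreover have "a ^ (p - 1) * a = a ^ p" using p1 by (intro power_minus_mult) simp
  ultimately have "[a ^ p = a] (mod p)" by simp
  then show ?thesis using a by (rule cong_trans[OF cong_sym])
qed

text \<open>If every element of \<open>C - A\<close> had a commutator outside \<open>A\<close>,
  iterated commutators would produce elements of \<open>C - A\<close> in every term of the lower
  central series, although some term is trivial. With \<open>C\<close> the centralizer of
  \<open>x\<close> and \<open>A\<close> the normal subgroup generated by \<open>x\<close>, this
  yields an element of \<open>C - A\<close> that is central modulo \<open>A\<close>.\<close>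

lemma nilpotent_relatively_central:
  assumes nil: "nilpotent_group G" and C: "C \<subseteq> carrier G" "\<not> C \<subseteq> A" and "\<one>\<^bsub>G\<^esub> \<in> A"
    and comm: "\<And>c g. \<lbrakk>c \<in> C; g \<in> carrier G\<rbrakk> \<Longrightarrow> c \<otimes>\<^bsub>G\<^esub> g \<otimes>\<^bsub>G\<^esub> inv\<^bsub>G\<^esub> c \<otimes>\<^bsub>G\<^esub> inv\<^bsub>G\<^esub> g \<in> C"
  shows "\<exists>c \<in> C - A. \<forall>g \<in> carrier G. c \<otimes>\<^bsub>G\<^esub> g \<otimes>\<^bsub>G\<^esub> inv\<^bsub>G\<^esub> c \<otimes>\<^bsub>G\<^esub> inv\<^bsub>G\<^esub> g \<in> A"
proof (rule ccontr)
  assume neg: "\<not> ?thesis"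
  have "\<exists>c \<in> C - A. c \<in> lower_central_series G n" for n
  proof (induction n)
    case 0
    then show ?case using C by auto
  next
    case (Suc n)
    then obtain c where c: "c \<in> C - A" "c \<in> lower_central_series G n" by blast
    obtain g where "g \<in> carrier G" "c \<otimes>\<^bsub>G\<^esub> g \<otimes>\<^bsub>G\<^esub> inv\<^bsub>G\<^esub> c \<otimes>\<^bsub>G\<^esub> inv\<^bsub>G\<^esub> g \<notin> A"
      using neg c by blast
    then have "c \<otimes>\<^bsub>G\<^esub> g \<otimes>\<^bsub>G\<^esub> inv\<^bsub>G\<^esub> c \<otimes>\<^bsub>G\<^esub> inv\<^bsub>G\<^esub> g \<in> C - A"
      and "c \<otimes>\<^bsub>G\<^esub> g \<otimes>\<^bsub>G\<^esub> inv\<^bsub>G\<^esub> c \<otimes>\<^bsub>G\<^esub> inv\<^bsub>G\<^esub> g \<in> lower_central_series G (Suc n)"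
      using comm c by (auto intro!: generate.incl)
    then show ?case by blast
  qed
  then show False using nil \<open>\<one>\<^bsub>G\<^esub> \<in> A\<close> by (metis nilpotent_group_def DiffD2 singletonD)
qed

section \<open>Powers and roots of generators of cyclic subgroups\<close>

context group
begin

lemma mem_generate_iff:
  assumes "finite (carrier G)" "x \<in> carrier G"
  shows "y \<in> generate G {x} \<longleftrightarrow> (\<exists>i::nat. y = x [^] i)"
  using generate_pow_on_finite_carrier[OF assms] by auto

lemma generate_singleton_mono:
  assumes "y \<in> generate G {x}" "x \<in> carrier G"
  shows "generate G {y} \<subseteq> generate G {x}"
  using assms by (intro generate_subgroup_incl generate_is_subgroup) auto

lemma pow_eq_iff_cong:
  assumes "x \<in> carrier G"
  shows "x [^] (i::nat) = x [^] (j::nat) \<longleftrightarrow> [i = j] (mod ord x)"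
proof -
  have "x [^] i = x [^] j \<longleftrightarrow> x [^] int i = x [^] int j" by (simp add: int_pow_int)
  also have "\<dots> \<longleftrightarrow> [int j = int i] (mod int (ord x))"
    using assms by (simp add: int_pow_eq cong_iff_dvd_diff)
  also have "\<dots> \<longleftrightarrow> [i = j] (mod ord x)" by (auto simp: cong_int_iff cong_sym_eq)
  finally show ?thesis .
qed

lemma semicommute_pow_right:
  assumes "x \<in> carrier G" "y \<in> carrier G" "y \<otimes> x = x [^] (a::nat) \<otimes> y"
  shows "y \<otimes> x [^] (i::nat) = x [^] (a * i) \<otimes> y"
proof (induction i)
  case (Suc i)
  have "y \<otimes> x [^] Suc i = (y \<otimes> x [^] i) \<otimes> x" using assms by (simp add: m_assoc)
  also have "\<dots> = x [^] (a * i) \<otimes> (y \<otimes> x)" using assms Suc by (simp add: m_assoc)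
  also have "\<dots> = (x [^] (a * i) \<otimes> x [^] a) \<otimes> y" using assms by (simp add: m_assoc)
  also have "\<dots> = x [^] (a * Suc i) \<otimes> y" using assms by (simp add: nat_pow_mult add.commute)
  finally show ?case .
qed (use assms in simp)

lemma semicommute_pow_left:
  assumes "x \<in> carrier G" "y \<in> carrier G" "y \<otimes> x = x [^] (a::nat) \<otimes> y"
  shows "y [^] (k::nat) \<otimes> x = x [^] (a ^ k) \<otimes> y [^] k"
proof (induction k)
  case (Suc k)
  have "y [^] Suc k \<otimes> x = y \<otimes> (y [^] k \<otimes> x)"
    using assms by (simp only: nat_pow_Suc2) (simp add: m_assoc)
  also have "\<dots> = (y \<otimes> x [^] (a ^ k)) \<otimes> y [^] k" using assms Suc by (simp add: m_assoc)
  also have "\<dots> = x [^] (a ^ Suc k) \<otimes> (y \<otimes> y [^] k)"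
    using assms by (simp add: semicommute_pow_right m_assoc)
  also have "\<dots> = x [^] (a ^ Suc k) \<otimes> y [^] Suc k" using assms by (simp only: nat_pow_Suc2)
  finally show ?case .
qed (use assms in simp)

text \<open>Each move of \<open>y\<close> past a power of \<open>x\<close> multiplies the exponent
  by \<open>a\<close>, so a geometric sum accumulates.\<close>

lemma semicommute_mult_pow:
  assumes "x \<in> carrier G" "y \<in> carrier G" "y \<otimes> x = x [^] (a::nat) \<otimes> y"
  shows "(x [^] (i::nat) \<otimes> y) [^] (k::nat) = x [^] (i * (\<Sum>l<k. a ^ l)) \<otimes> y [^] k"
proof (induction k)
  case (Suc k)
  let ?s = "i * (\<Sum>l<k. a ^ l)"
  have "(x [^] i \<otimes> y) [^] Suc k = (x [^] i \<otimes> y) \<otimes> (x [^] ?s \<otimes> y [^] k)"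
    using assms Suc by (simp only: nat_pow_Suc2 m_closed nat_pow_closed)
  also have "\<dots> = x [^] i \<otimes> (y \<otimes> x [^] ?s) \<otimes> y [^] k" using assms by (simp add: m_assoc)
  also have "\<dots> = (x [^] i \<otimes> x [^] (a * ?s)) \<otimes> (y \<otimes> y [^] k)"
    using assms by (simp add: semicommute_pow_right m_assoc)
  also have "\<dots> = x [^] (i + a * ?s) \<otimes> y [^] Suc k"
    using assms by (simp only: nat_pow_Suc2 nat_pow_mult)
  also have "i + a * ?s = i * (\<Sum>l<Suc k. a ^ l)"
    by (simp add: sum.lessThan_Suc_shift sum_distrib_left algebra_simps del: sum.lessThan_Suc)
  finally show ?case .
qed (use assms in simp)

lemma commute_generate:
  assumes fin: "finite (carrier G)" and "x \<in> carrier G" "c \<in> carrier G" "c \<otimes> x = x \<otimes> c"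
    and "a \<in> generate G {x}"
  shows "c \<otimes> a = a \<otimes> c"
  using assms by (auto simp: mem_generate_iff group_commutes_pow)

text \<open>The last of the iterated \<open>p\<close>-th powers of \<open>g\<close> to stay outside
  \<open>A\<close> works. It reduces questions about elements outside \<open>A\<close> to elements
  whose \<open>p\<close>-th power already lies in \<open>A\<close>.\<close>

lemma prime_power_outside:
  fixes p :: nat
  assumes "g [^] (p ^ n) \<in> A" "g \<in> carrier G" "g \<notin> A"
  shows "\<exists>k. g [^] (p ^ k) \<notin> A \<and> (g [^] (p ^ k)) [^] p \<in> A"
proof -
  define k where "k = (LEAST k. g [^] (p ^ k) \<in> A)"
  have k: "g [^] (p ^ k) \<in> A" unfolding k_def using assms(1) by (rule LeastI)
  then obtain l where l: "k = Suc l" using assms by (cases k) (auto)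
  have "g [^] (p ^ l) \<notin> A" using l not_less_Least[of l "\<lambda>k. g [^] (p ^ k) \<in> A"] k_def by simp
  moreover have "(g [^] (p ^ l)) [^] p \<in> A"
    using k l assms by (simp add: nat_pow_pow mult.commute)
  ultimately show ?thesis by blast
qed

text \<open>As \<open>ord x\<close> is a power of \<open>p\<close>, the exponent \<open>j\<close> is
  invertible modulo it, so \<open>x\<close> is a power of \<open>x [^] j\<close> and hence of
  \<open>y\<close>.\<close>

lemma coprime_root_generates:
  fixes p :: nat
  assumes fin: "finite (carrier G)" and p: "Factorial_Ring.prime p" and ord: "order G = p ^ N"
    and x: "x \<in> carrier G" and y: "y \<in> carrier G"
    and j: "y [^] p = x [^] (j::nat)" and "\<not> p dvd j"
  shows "x \<in> generate G {y}"
proof -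
  have "ord x dvd p ^ N" using ord_dvd_group_order[OF x] ord by simp
  then have "coprime j (ord x)"
    using prime_imp_coprime[OF p \<open>\<not> p dvd j\<close>] coprime_divisors[of j j "ord x" "p ^ N"]
    by (simp add: coprime_commute)
  then obtain i where "[j * i = 1] (mod ord x)" using cong_solve_coprime_nat[of j "ord x"] by auto
  then have "x [^] (j * i) = x [^] (1::nat)" using x by (simp only: pow_eq_iff_cong)
  then have "x = (y [^] p) [^] i" using x j by (simp add: nat_pow_pow)
  then have "x = y [^] (p * i)" using y by (simp add: nat_pow_pow)
  then show ?thesis using fin y by (auto simp: mem_generate_iff)
qed

text \<open>Let \<open>y [^] p = x [^] j\<close>. If \<open>j = p * j'\<close>, the commuting
  product of \<open>y\<close> with the inverse of \<open>x [^] j'\<close> has trivial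
  \<open>p\<close>-th power, so it lies in the group generated by \<open>x\<close>, and then so does
  \<open>y\<close>. Hence \<open>p\<close> does not divide \<open>j\<close>, and \<open>x\<close> is
  a power of \<open>y\<close>. The torsion hypothesis is guarded by \<open>x \<noteq> \<one>\<close>
  because it can fail for the trivial subgroup, where the conclusion is immediate.\<close>

lemma commuting_root_generates:
  fixes p :: nat
  assumes fin: "finite (carrier G)" and p: "Factorial_Ring.prime p" and ord: "order G = p ^ N"
    and x: "x \<in> carrier G" and y: "y \<in> carrier G" and xy: "y \<otimes> x = x \<otimes> y"
    and tors: "\<And>u. \<lbrakk>u \<in> carrier G; u [^] p = \<one>; x \<noteq> \<one>\<rbrakk> \<Longrightarrow> u \<in> generate G {x}"
    and out: "y \<notin> generate G {x}" and yp: "y [^] p \<in> generate G {x}"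
  shows "x \<in> generate G {y}"
proof (cases "x = \<one>")
  case True
  then show ?thesis by (simp add: generate.one)
next
  case False
  obtain j where j: "y [^] p = x [^] (j::nat)" using yp fin x by (auto simp: mem_generate_iff)
  show ?thesis
  proof (cases "p dvd j")
    case True
    then obtain j' where j': "j = p * j'" by blast
    let ?z = "inv (x [^] j') \<otimes> y"
    have c: "inv (x [^] j') \<otimes> y = y \<otimes> inv (x [^] j')"
      using x y xy group_commutes_pow[of x y j']
      by (metis inv_solve_left inv_solve_right m_assoc m_closed nat_pow_closed inv_closed)
    have "?z [^] p = inv (x [^] j') [^] p \<otimes> y [^] p"
      by (rule pow_mult_distrib[OF c]) (use x y in auto)
    also have "\<dots> = \<one>"
      using x y j j' by (simp add: nat_pow_inv nat_pow_pow mult.commute)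
    finally have "?z \<in> generate G {x}" using tors[of ?z] False x y by simp
    moreover have "x [^] j' \<in> generate G {x}" using fin x by (auto simp: mem_generate_iff)
    ultimately have "x [^] j' \<otimes> ?z \<in> generate G {x}" by (rule generate.eng[rotated])
    moreover have "x [^] j' \<otimes> ?z = y" using x y by (simp add: m_assoc[symmetric])
    ultimately show ?thesis using out by simp
  next
    case False
    with fin p ord x y j show ?thesis by (rule coprime_root_generates)
  qed
qed

end

text \<open>Here \<open>a - 1\<close> is twice an odd number and absorbs exactly one factor
  2.\<close>

lemma two_power_dvd_of_three_mod_four:
  fixes a m :: nat
  assumes "2 ^ n dvd (a - 1) * m" "a mod 4 = 3"
  shows "2 ^ (n - 1) dvd m"
proof (cases n)
  case (Suc k)
  obtain t where t: "a = 4 * t + 3" using assms(2) by (metis mult.commute div_mult_mod_eq)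
  then have "2 * 2 ^ k dvd 2 * ((2 * t + 1) * m)" using assms(1) Suc by (simp add: algebra_simps)
  then have "2 ^ k dvd (2 * t + 1) * m" by (rule nat_mult_dvd_cancel1[THEN iffD1, rotated]) simp
  moreover have "coprime (2 ^ k) (2 * t + 1)" by simp
  ultimately show ?thesis using Suc by (simp only: coprime_dvd_mult_right_iff) simp
qed (simp)

section \<open>Self-centralizing normal cyclic subgroups and inverting elements\<close>

context group
begin

lemma mult_inv_cancel_left [simp]:
  assumes "g \<in> carrier G" "z \<in> carrier G"
  shows "inv g \<otimes> (g \<otimes> z) = z" "g \<otimes> (inv g \<otimes> z) = z"
  using assms by (simp_all add: m_assoc[symmetric])

lemma conj_pow:
  assumes "g \<in> carrier G" "c \<in> carrier G"
  shows "(g \<otimes> c \<otimes> inv g) [^] (m::nat) = g \<otimes> c [^] m \<otimes> inv g"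
proof (induction m)
  case (Suc m)
  have "(g \<otimes> c \<otimes> inv g) [^] Suc m = g \<otimes> c [^] m \<otimes> (inv g \<otimes> g) \<otimes> c \<otimes> inv g"
    using Suc assms by (simp add: m_assoc)
  then show ?case using assms by (simp add: m_assoc)
qed (use assms in simp)

lemma exists_prime_order_in_generate:
  fixes p :: nat
  assumes fin: "finite (carrier G)" and p: "Factorial_Ring.prime p"
    and x: "x \<in> carrier G" and dvd: "p dvd ord x"
  shows "\<exists>z \<in> generate G {x}. z \<noteq> \<one> \<and> z [^] p = \<one>"
proof -
  obtain m where m: "ord x = p * m" using dvd by blast
  have "ord x > 0" using ord_ge_1[OF fin x] by simp
  then have m0: "m > 0" using m by simp
  have "m < ord x" using m m0 prime_gt_1_nat[OF p] by simp
  then have "\<not> ord x dvd m" using m0 by (auto dest: dvd_imp_le)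
  then have "x [^] m \<noteq> \<one>" using x by (simp add: pow_eq_id)
  moreover have "(x [^] m) [^] p = \<one>"
    using x m by (simp add: nat_pow_pow mult.commute pow_eq_id)
  moreover have "x [^] m \<in> generate G {x}" using fin x by (auto simp: mem_generate_iff)
  ultimately show ?thesis by blast
qed

lemma prime_dvd_ord_p_group:
  fixes p :: nat
  assumes p: "Factorial_Ring.prime p" and ord: "order G = p ^ N"
    and x: "x \<in> carrier G" "x \<noteq> \<one>"
  shows "p dvd ord x"
proof -
  have "ord x dvd p ^ N" using ord_dvd_group_order[of x] x ord by simp
  then obtain n where n: "ord x = p ^ n" using p divides_primepow_nat by blast
  moreover have "ord x \<noteq> 1" using x ord_eq_1 by blast
  ultimately have "n \<noteq> 0" by (metis power_0)
  then show ?thesis using n by simp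
qed

text \<open>Choose \<open>x\<close> of largest order among generators of normal cyclic subgroups. If
  its centralizer were larger than the subgroup \<open>A\<close> it generates, nilpotency would give
  a centralizing \<open>c\<close> outside \<open>A\<close> that is central modulo \<open>A\<close>.
  A suitable power \<open>d\<close> of \<open>c\<close> then generates a strictly larger cyclic
  subgroup, which is still normal, against maximality.\<close>

lemma normal_cyclic_self_centralizing:
  fixes p :: nat
  assumes fin: "finite (carrier G)" and p: "Factorial_Ring.prime p" and ord: "order G = p ^ N"
    and nil: "nilpotent_group G"
    and uniq: "\<And>u v. \<lbrakk>u \<in> carrier G; v \<in> carrier G; u [^] p = \<one>; v [^] p = \<one>; v \<noteq> \<one>\<rbrakk>
                \<Longrightarrow> u \<in> generate G {v}"
  shows "\<exists>x \<in> carrier G. (\<forall>g \<in> carrier G. g \<otimes> x \<otimes> inv g \<in> generate G {x}) \<and>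
           (\<forall>c \<in> carrier G. c \<otimes> x = x \<otimes> c \<longrightarrow> c \<in> generate G {x})"
proof -
  define Nc where "Nc = {x \<in> carrier G. \<forall>g \<in> carrier G. g \<otimes> x \<otimes> inv g \<in> generate G {x}}"
  have "finite Nc" "\<one> \<in> Nc" using fin by (auto simp: Nc_def generate.one)
  then have "Max (ord ` Nc) \<in> ord ` Nc" by (intro Max_in) auto
  then obtain x where xX: "x \<in> Nc" and "ord x = Max (ord ` Nc)" by auto
  then have max: "ord z \<le> ord x" if "z \<in> Nc" for z using that \<open>finite Nc\<close> by simp
  have x: "x \<in> carrier G" and norm: "\<And>g. g \<in> carrier G \<Longrightarrow> g \<otimes> x \<otimes> inv g \<in> generate G {x}"
    using xX by (auto simp: Nc_def)
  let ?A = "generate G {x}"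
  interpret A: subgroup ?A G using x by (intro generate_is_subgroup) simp
  define C where "C = {c \<in> carrier G. c \<otimes> x = x \<otimes> c}"
  have Ccar: "C \<subseteq> carrier G" by (auto simp: C_def)
  have C_mult: "c \<otimes> d \<in> C" if "c \<in> C" "d \<in> C" for c d
  proof -
    have cd: "c \<in> carrier G" "d \<in> carrier G" "c \<otimes> x = x \<otimes> c" "d \<otimes> x = x \<otimes> d"
      using that by (auto simp: C_def)
    have "c \<otimes> d \<otimes> x = (c \<otimes> x) \<otimes> d" using cd(1,2,4) x by (simp add: m_assoc)
    also have "\<dots> = x \<otimes> (c \<otimes> d)" unfolding cd(3) using cd(1,2) x by (simp add: m_assoc)
    finally show ?thesis using cd(1,2) by (simp add: C_def)
  qed
  have C_inv: "inv c \<in> C" if "c \<in> C" for c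
  proof -
    have c: "c \<in> carrier G" "c \<otimes> x = x \<otimes> c" using that by (auto simp: C_def)
    have "inv c \<otimes> x = inv c \<otimes> (x \<otimes> c) \<otimes> inv c" using c(1) x by (simp add: m_assoc)
    also have "\<dots> = (inv c \<otimes> c) \<otimes> x \<otimes> inv c" using c x by (simp only: m_assoc m_closed inv_closed flip: c(2))
    finally show ?thesis using c(1) x by (simp add: C_def)
  qed
  have C_conj: "g \<otimes> c \<otimes> inv g \<in> C" if "c \<in> C" "g \<in> carrier G" for c g
  proof -
    have c: "c \<in> carrier G" "c \<otimes> x = x \<otimes> c" using that by (auto simp: C_def)
    let ?x = "inv g \<otimes> x \<otimes> g"
    have "?x \<in> ?A" using norm[of "inv g"] that by simp
    then have cx: "c \<otimes> ?x = ?x \<otimes> c" by (rule commute_generate[OF fin x c])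
    have "(g \<otimes> c \<otimes> inv g) \<otimes> x = g \<otimes> (c \<otimes> ?x) \<otimes> inv g"
      using c(1) x that(2) by (simp add: m_assoc)
    also have "\<dots> = (g \<otimes> inv g) \<otimes> x \<otimes> (g \<otimes> c \<otimes> inv g)"
      unfolding cx using c(1) x that(2) by (simp add: m_assoc)
    finally show ?thesis using c(1) x that(2) by (simp add: C_def)
  qed
  have "C \<subseteq> ?A"
  proof (rule ccontr)
    assume "\<not> C \<subseteq> ?A"
    moreover have "c \<otimes> g \<otimes> inv c \<otimes> inv g \<in> C" if "c \<in> C" "g \<in> carrier G" for c g
    proof -
      have "c \<otimes> (g \<otimes> inv c \<otimes> inv g) \<in> C" using that by (intro C_mult C_conj C_inv)
      moreover have "c \<in> carrier G" using that Ccar by blast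
      ultimately show ?thesis using that(2) by (simp add: m_assoc)
    qed
    ultimately obtain c where c: "c \<in> C" "c \<notin> ?A"
      and cA: "\<And>g. g \<in> carrier G \<Longrightarrow> c \<otimes> g \<otimes> inv c \<otimes> inv g \<in> ?A"
      using nilpotent_relatively_central[OF nil Ccar _ A.one_closed] by blast
    have cc: "c \<in> carrier G" "c \<otimes> x = x \<otimes> c" using c by (auto simp: C_def)
    have "c [^] (p ^ N) = \<one>" using pow_order_eq_1[OF cc(1)] ord by simp
    then obtain k where k: "c [^] (p ^ k) \<notin> ?A" "(c [^] (p ^ k)) [^] p \<in> ?A"
      using prime_power_outside[of c p N ?A] cc c by auto
    define d where "d = c [^] (p ^ k)"
    have d: "d \<in> carrier G" using cc by (simp add: d_def)
    have dx: "d \<otimes> x = x \<otimes> d" unfolding d_def using cc x by (intro group_commutes_pow)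
    \<comment> \<open>A nontrivial \<open>x\<close> has a power of order \<open>p\<close>; by
      uniqueness that power generates every element of exponent \<open>p\<close>.\<close>
    have tors: "u \<in> ?A" if "u \<in> carrier G" "u [^] p = \<one>" "x \<noteq> \<one>" for u
    proof -
      have "p dvd ord x" using p ord x that(3) by (rule prime_dvd_ord_p_group)
      with fin p x obtain z where z: "z \<in> ?A" "z \<noteq> \<one>" "z [^] p = \<one>"
        by (meson exists_prime_order_in_generate)
      then have "u \<in> generate G {z}" using that(1,2) A.subset by (intro uniq) auto
      then show ?thesis using generate_singleton_mono[OF z(1) x] by blast
    qed
    have xd: "x \<in> generate G {d}"
      using commuting_root_generates[OF fin p ord x d dx tors] k by (simp add: d_def)
    then have Ad: "?A \<subseteq> generate G {d}" by (rule generate_singleton_mono) (rule d)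
    have dd: "d \<in> generate G {d}" by (simp add: generate.incl)
    have "g \<otimes> d \<otimes> inv g \<in> generate G {d}" if g: "g \<in> carrier G" for g
    proof -
      \<comment> \<open>The inverse commutator is chosen so that conjugating \<open>c\<close> by
        \<open>g\<close> gives \<open>a \<otimes> c\<close>. Since \<open>a\<close> lies in
        \<open>?A\<close>, it commutes with \<open>c\<close>, and the power \<open>p ^ k\<close> can
        be taken factor by factor. The result stays in the group generated by \<open>d\<close>,
        which contains \<open>?A\<close>.\<close>
      define a where "a = inv (c \<otimes> g \<otimes> inv c \<otimes> inv g)"
      have a: "a \<in> ?A" unfolding a_def using cA[OF g] by (rule A.m_inv_closed)
      have "c \<otimes> a = a \<otimes> c" using a by (rule commute_generate[OF fin x cc])
      moreover have "a \<in> carrier G" using a A.subset by blast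
      moreover have "g \<otimes> c \<otimes> inv g = a \<otimes> c"
        using cc(1) g by (simp add: a_def inv_mult_group m_assoc)
      ultimately have "(g \<otimes> c \<otimes> inv g) [^] (p ^ k) = a [^] (p ^ k) \<otimes> d"
        using cc(1) unfolding d_def by (simp add: pow_mult_distrib)
      then have "g \<otimes> d \<otimes> inv g = a [^] (p ^ k) \<otimes> d"
        using conj_pow[OF g cc(1)] by (simp add: d_def)
      moreover have "a [^] (p ^ k) \<in> ?A"
        using a x fin by (auto simp: mem_generate_iff nat_pow_pow)
      ultimately show ?thesis using Ad dd by (auto intro: generate.eng)
    qed
    then have "d \<in> Nc" using d by (simp add: Nc_def)
    moreover have "card ?A < card (generate G {d})"
      using Ad dd k(1) d fin generate_incl[of "{d}"]
      by (intro psubset_card_mono) (auto simp: d_def intro: finite_subset)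
    then have "ord x < ord d" using x d fin by (simp add: generate_pow_card)
    ultimately show False using max by (meson not_less)
  qed
  then show ?thesis using x norm by (auto simp: C_def)
qed

text \<open>Conjugation by \<open>y\<close> sends \<open>x\<close> to \<open>x [^] a\<close>, and
  \<open>a\<close> is 1 modulo \<open>p\<close> because \<open>y [^] p\<close> centralizes
  \<open>x\<close>. The \<open>p\<close>-th power of \<open>x [^] i \<otimes> y\<close> is a power
  of \<open>x\<close> with exponent affine in \<open>i\<close>. It is never trivial, since all
  elements of exponent \<open>p\<close> are powers of \<open>x\<close> while \<open>y\<close> is
  not. An exponent that can be made zero is therefore excluded, which leaves \<open>p = 2\<close>
  and \<open>a\<close> equal to 3 modulo 4.\<close>

lemma inverting_root:
  fixes p :: nat
  assumes fin: "finite (carrier G)" and p: "Factorial_Ring.prime p" and ord: "order G = p ^ N"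
    and x: "x \<in> carrier G" "x \<noteq> \<one>"
    and norm: "\<And>g. g \<in> carrier G \<Longrightarrow> g \<otimes> x \<otimes> inv g \<in> generate G {x}"
    and cent: "\<And>c. \<lbrakk>c \<in> carrier G; c \<otimes> x = x \<otimes> c\<rbrakk> \<Longrightarrow> c \<in> generate G {x}"
    and tors: "\<And>u. \<lbrakk>u \<in> carrier G; u [^] p = \<one>\<rbrakk> \<Longrightarrow> u \<in> generate G {x}"
    and y: "y \<in> carrier G" "y \<notin> generate G {x}" "y [^] p \<in> generate G {x}"
  shows "p = 2 \<and> y \<otimes> x = inv x \<otimes> y \<and>
         (\<exists>n\<ge>2. ord x = 2 ^ n \<and> y [^] (2::nat) = x [^] (2 ^ (n - 1) :: nat))"
proof -
  interpret A: subgroup "generate G {x}" G using x by (intro generate_is_subgroup) simp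
  have "ord x dvd p ^ N" using ord_dvd_group_order[OF x(1)] ord by simp
  then obtain n where n: "ord x = p ^ n" using p divides_primepow_nat by blast
  have p_dvd: "p dvd ord x" by (rule prime_dvd_ord_p_group[OF p ord x])
  obtain a where "y \<otimes> x \<otimes> inv y = x [^] (a::nat)"
    using norm[OF y(1)] fin x by (auto simp: mem_generate_iff)
  then have a: "y \<otimes> x = x [^] a \<otimes> y" using x y by (metis inv_solve_right' m_closed nat_pow_closed)
  obtain j where j: "y [^] p = x [^] (j::nat)" using y(3) fin x by (auto simp: mem_generate_iff)
  have ncomm: "y \<otimes> x \<noteq> x \<otimes> y" using cent y by blast
  have ap: "[a ^ p = 1] (mod ord x)"
  proof -
    have "x [^] (a ^ p) \<otimes> y [^] p = y [^] p \<otimes> x"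
      using semicommute_pow_left[OF x(1) y(1) a] by simp
    also have "\<dots> = x [^] (1::nat) \<otimes> y [^] p"
      using x j by (simp add: group_commutes_pow)
    finally have "x [^] (a ^ p) = x [^] (1::nat)" using x y by simp
    then show ?thesis using x pow_eq_iff_cong by blast
  qed
  then have "[a ^ p = 1] (mod p)" using p_dvd cong_dvd_modulus_nat by blast
  then have a1: "[a = 1] (mod p)" by (rule cong_one_of_prime_power[OF p])
  \<comment> \<open>Otherwise \<open>x\<close> would be a power of \<open>y\<close> and would
    commute with it.\<close>
  have "p dvd j"
  proof (rule ccontr)
    assume "\<not> p dvd j"
    with fin p ord x(1) y(1) j have "x \<in> generate G {y}" by (rule coprime_root_generates)
    then have "y \<otimes> x = x \<otimes> y" by (rule commute_generate[OF fin y(1) y(1) refl])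
    then show False using ncomm by blast
  qed
  then obtain j' where j': "j = p * j'" by blast
  have no_root: "(x [^] i \<otimes> y) [^] p \<noteq> \<one>" for i :: nat
  proof
    assume "(x [^] i \<otimes> y) [^] p = \<one>"
    then have "x [^] i \<otimes> y \<in> generate G {x}" using tors x y by simp
    moreover have "inv (x [^] i) \<in> generate G {x}"
      using fin x by (intro A.m_inv_closed) (auto simp: mem_generate_iff)
    ultimately have "inv (x [^] i) \<otimes> (x [^] i \<otimes> y) \<in> generate G {x}" by (rule A.m_closed[rotated])
    moreover have "inv (x [^] i) \<otimes> (x [^] i \<otimes> y) = y" using x y by (simp add: m_assoc[symmetric])
    ultimately show False using y by simp
  qed
  have root: "(x [^] i \<otimes> y) [^] p = x [^] (i * (\<Sum>l<p. a ^ l) + j)" for i :: nat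
    using semicommute_mult_pow[OF x(1) y(1) a] j x by (simp add: nat_pow_mult)
  have "\<not> (\<exists>u. coprime u p \<and> (\<Sum>l<p. a ^ l) = p * u)"
  proof
    assume "\<exists>u. coprime u p \<and> (\<Sum>l<p. a ^ l) = p * u"
    then obtain u where u: "coprime u p" "(\<Sum>l<p. a ^ l) = p * u" by blast
    then have "coprime u (ord x)" using n by simp
    then obtain v where v: "[u * v = 1] (mod ord x)" using cong_solve_coprime_nat[of u "ord x"] by auto
    \<comment> \<open>This solves \<open>u * i + j' = 0\<close> modulo \<open>ord x\<close>:
      \<open>v\<close> inverts \<open>u\<close>, and \<open>ord x - 1\<close> stands for -1 among
      natural exponents.\<close>
    define i where "i = v * ((ord x - 1) * j')"
    have "[u * v * ((ord x - 1) * j') + j' = 1 * ((ord x - 1) * j') + j'] (mod ord x)"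
      using v by (intro cong_add cong_scalar_right cong_refl)
    moreover have "1 * ((ord x - 1) * j') + j' = ord x * j'"
      using ord_ge_1[OF fin x(1)] by (simp add: algebra_simps)
    ultimately have "[u * i + j' = ord x * j'] (mod ord x)" by (simp add: i_def mult.assoc)
    then have "ord x dvd u * i + j'" using cong_dvd_iff[of "u * i + j'" "ord x * j'" "ord x"] by simp
    then have "ord x dvd p * (u * i + j')" by simp
    then have "x [^] (i * (\<Sum>l<p. a ^ l) + j) = \<one>"
      using x u(2) j' by (simp add: pow_eq_id algebra_simps)
    then show False using no_root[of i] root[of i] by simp
  qed
  then have p2: "p = 2" and "\<not> [a = 1] (mod 4)" using sum_powers_cong_one[OF p a1] by blast+
  moreover have "odd a" using a1 p2 by (simp add: cong_def odd_iff_mod_2_eq_one)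
  ultimately have a3: "a mod 4 = 3" unfolding cong_def by presburger
  have "ord x \<noteq> 1" using x ord_eq_1 by blast
  then have n1: "n \<noteq> 0" using n by (metis power_0)
  \<comment> \<open>If \<open>x\<close> had order 2, the odd exponent \<open>a\<close> would act
    trivially and \<open>y\<close> would commute with \<open>x\<close>.\<close>
  have "n \<noteq> 1"
  proof
    assume "n = 1"
    then have "x [^] a = x [^] (1::nat)" using a1 n x by (subst pow_eq_iff_cong) auto
    then show False using a ncomm x by simp
  qed
  with n1 have n2: "n \<ge> 2" by simp
  define h :: nat where "h = 2 ^ (n - 1)"
  have h: "ord x = 2 * h" using n n1 p2 by (cases n) (auto simp: h_def)
  have h0: "h > 0" by (simp add: h_def)
  \<comment> \<open>The order \<open>2 * h\<close> divides \<open>a ^ 2 - 1\<close>, and the factor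
    \<open>a - 1\<close> of it contains only one factor 2.\<close>
  have "h dvd a + 1"
  proof -
    have "a ^ 2 = (a - 1) * (a + 1) + 1" using a3 by (cases a) (auto simp: power2_eq_square)
    then have "[(a - 1) * (a + 1) + 1 = 0 + 1] (mod ord x)" using ap p2 by simp
    then have "ord x dvd (a - 1) * (a + 1)" using cong_add_rcancel_nat cong_0_iff by blast
    then show ?thesis using a3 n p2 unfolding h_def by (intro two_power_dvd_of_three_mod_four[of n a]) auto
  qed
  then obtain b where b: "a + 1 = h * b" by blast
  \<comment> \<open>Conjugation by \<open>y\<close> fixes \<open>x [^] j\<close>, which is a power
    of \<open>y\<close>; so \<open>ord x\<close> divides \<open>(a - 1) * j\<close>.\<close>
  have "h dvd j"
  proof -
    have "x [^] (a * j) \<otimes> y = y \<otimes> x [^] j" using semicommute_pow_right[OF x(1) y(1) a] by simp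
    also have "\<dots> = x [^] j \<otimes> y" unfolding j[symmetric] using y nat_pow_comm[of y 1 p] by simp
    finally have "x [^] (a * j) = x [^] j" using x y by simp
    then have "[a * j = j] (mod ord x)" using x pow_eq_iff_cong by blast
    moreover have "a * j = (a - 1) * j + j" using a3 by (cases a) auto
    ultimately have "[(a - 1) * j + j = 0 + j] (mod ord x)" by simp
    then have "ord x dvd (a - 1) * j" using cong_add_rcancel_nat cong_0_iff by blast
    then show ?thesis using a3 n p2 unfolding h_def by (intro two_power_dvd_of_three_mod_four[of n a]) auto
  qed
  then obtain e where e: "j = h * e" by blast
  have S: "(\<Sum>l<p. a ^ l) = a + 1" using p2 by (simp add: numeral_2_eq_2)
  \<comment> \<open>The choices \<open>i = 0\<close> and \<open>i = 1\<close> show that neither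
    \<open>j = h * e\<close> nor \<open>a + 1 + j = h * (b + e)\<close> is a multiple of
    \<open>2 * h\<close>. So \<open>e\<close> and \<open>b + e\<close> are odd and \<open>b\<close>
    is even: \<open>x [^] a\<close> is the inverse of \<open>x\<close>, and \<open>j\<close> is
    \<open>h\<close> modulo \<open>ord x\<close>.\<close>
  have "\<not> ord x dvd j" using no_root[of 0] root[of 0] x by (simp add: pow_eq_id)
  then have "odd e" using e h by auto
  have "\<not> ord x dvd a + 1 + j" using no_root[of 1] root[of 1] x S by (simp only: mult_1 pow_eq_id) simp
  moreover have "a + 1 + j = h * (b + e)" using b e by (simp add: algebra_simps)
  ultimately have "odd (b + e)" using h by auto
  then have "even b" using \<open>odd e\<close> by simp
  then have "ord x dvd a + 1" using b h by auto
  then have "x [^] (a + 1) = \<one>" using pow_eq_id[OF x(1)] by blast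
  then have "x [^] a \<otimes> x = \<one>" using x by simp
  then have "inv x = x [^] a" using x by (intro inv_equality) auto
  moreover have "[j = h] (mod ord x)"
  proof -
    obtain f where "e = 2 * f + 1" using \<open>odd e\<close> by (elim oddE)
    then have "j = ord x * f + h" using e h by (simp add: algebra_simps)
    then show ?thesis by (simp add: cong_def)
  qed
  then have "x [^] j = x [^] h" using x pow_eq_iff_cong by blast
  ultimately show ?thesis using p2 a n n2 j unfolding h_def by auto
qed

text \<open>Let \<open>A\<close> be the self-centralizing normal subgroup generated by
  \<open>x\<close>. If it is not everything, some \<open>y\<close> outside it inverts
  \<open>x\<close> and squares to the involution of \<open>A\<close>. Every other element outside
  \<open>A\<close> also inverts \<open>x\<close>, so \<open>A\<close> has index 2 and
  \<open>x\<close>, \<open>y\<close> satisfy the quaternion relations.\<close>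

lemma unique_prime_order_subgroup_imp:
  fixes p :: nat
  assumes fin: "finite (carrier G)" and p: "Factorial_Ring.prime p" and ord: "order G = p ^ N"
    and nil: "nilpotent_group G"
    and uniq: "\<And>u v. \<lbrakk>u \<in> carrier G; v \<in> carrier G; u [^] p = \<one>; v [^] p = \<one>; v \<noteq> \<one>\<rbrakk>
                \<Longrightarrow> u \<in> generate G {v}"
  shows "cyclic_group G \<or> generalized_quaternion_group G"
proof -
  obtain x where x: "x \<in> carrier G"
    and norm: "\<And>g. g \<in> carrier G \<Longrightarrow> g \<otimes> x \<otimes> inv g \<in> generate G {x}"
    and cent: "\<And>c. \<lbrakk>c \<in> carrier G; c \<otimes> x = x \<otimes> c\<rbrakk> \<Longrightarrow> c \<in> generate G {x}"
    using normal_cyclic_self_centralizing[OF fin p ord nil uniq] by blast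
  let ?A = "generate G {x}"
  interpret A: subgroup ?A G using x by (intro generate_is_subgroup) simp
  show ?thesis
  proof (cases "carrier G \<subseteq> ?A")
    case True
    moreover have "?A = range (\<lambda>n::int. x [^] n)"
      using generate_pow[OF x] by (simp add: full_SetCompr_eq)
    ultimately have "carrier G = range (\<lambda>n::int. x [^] n)" using A.subset by blast
    then show ?thesis using x cyclic_group by blast
  next
    case False
    then obtain g where g: "g \<in> carrier G" "g \<notin> ?A" by blast
    have x1: "x \<noteq> \<one>" using cent[of g] g by auto
    have "p dvd ord x" using p ord x x1 by (rule prime_dvd_ord_p_group)
    with fin p x obtain z where z: "z \<in> ?A" "z \<noteq> \<one>" "z [^] p = \<one>"
      by (meson exists_prime_order_in_generate)
    have tors: "u \<in> ?A" if "u \<in> carrier G" "u [^] p = \<one>" for u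
    proof -
      have "u \<in> generate G {z}" using that z A.subset by (intro uniq) auto
      then show ?thesis using generate_singleton_mono[OF z(1) x] by blast
    qed
    have inverting: "p = 2 \<and> y \<otimes> x = inv x \<otimes> y \<and>
        (\<exists>n\<ge>2. ord x = 2 ^ n \<and> y [^] (2::nat) = x [^] (2 ^ (n - 1) :: nat))"
      if "y \<in> carrier G" "y \<notin> ?A" "y [^] p \<in> ?A" for y
      by (rule inverting_root[OF fin p ord x x1]) (use norm cent tors that in blast)+
    have outside: "\<exists>k. g [^] (p ^ k) \<notin> ?A \<and> (g [^] (p ^ k)) [^] p \<in> ?A"
      if "g \<in> carrier G" "g \<notin> ?A" for g
    proof -
      have "g [^] (p ^ N) = \<one>" using pow_order_eq_1[OF that(1)] ord by simp
      then show ?thesis using prime_power_outside[of g p N ?A] that by simp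
    qed
    obtain k where "g [^] (p ^ k) \<notin> ?A" "(g [^] (p ^ k)) [^] p \<in> ?A" using outside[OF g] by blast
    then obtain y where y: "y \<in> carrier G" "y \<notin> ?A" "y [^] p \<in> ?A" using g by blast
    then obtain n where p2: "p = 2" and yx: "y \<otimes> x = inv x \<otimes> y"
      and n: "n \<ge> 2" "ord x = 2 ^ n" "y [^] (2::nat) = x [^] (2 ^ (n - 1) :: nat)"
      using inverting[OF y] by blast
    have inverts: "g \<otimes> x = inv x \<otimes> g" if g: "g \<in> carrier G" "g \<notin> ?A" for g
    proof -
      obtain k where k: "g [^] (p ^ k) \<notin> ?A" "(g [^] (p ^ k)) [^] p \<in> ?A" using outside[OF g] by blast
      then have inv: "g [^] (p ^ k) \<otimes> x = inv x \<otimes> g [^] (p ^ k)"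
        using inverting[of "g [^] (p ^ k)"] g(1) nat_pow_closed by blast
      show ?thesis
      proof (cases k)
        case 0
        then show ?thesis using inv g by simp
      next
        case (Suc l)
        \<comment> \<open>The inverting element is the square of \<open>h\<close>. If
          \<open>h\<close> sends \<open>x\<close> to \<open>x [^] b\<close>, then
          \<open>b ^ 2\<close> is -1 modulo \<open>ord x\<close>, a multiple of 4, which is
          impossible.\<close>
        define h where "h = g [^] (2 ^ l :: nat)"
        have h: "h \<in> carrier G" using g by (simp add: h_def)
        have "g [^] (p ^ k) = h [^] (2::nat)"
          using g Suc p2 by (simp add: h_def nat_pow_pow mult.commute)
        then have hx: "h [^] (2::nat) \<otimes> x = inv x \<otimes> h [^] (2::nat)" using inv by simp
        obtain b where "h \<otimes> x \<otimes> inv h = x [^] (b::nat)"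
          using norm[OF h] fin x by (auto simp: mem_generate_iff)
        then have "h \<otimes> x = x [^] b \<otimes> h" using x h by (metis inv_solve_right' m_closed nat_pow_closed)
        then have "h [^] (2::nat) \<otimes> x = x [^] (b ^ 2) \<otimes> h [^] (2::nat)"
          using semicommute_pow_left x h by blast
        then have "x [^] (b ^ 2) = inv x" using hx x h by simp
        then have "x [^] (b ^ 2 + 1) = \<one>" using x by simp
        then have "ord x dvd b ^ 2 + 1" using x pow_eq_id by blast
        moreover have "(4::nat) dvd ord x"
          using n le_imp_power_dvd[of 2 n "2::nat"] by simp
        ultimately have "4 dvd b ^ 2 + 1" by (rule dvd_trans[rotated])
        moreover have "\<not> 4 dvd b ^ 2 + 1"
        proof (cases "even b")
          case True
          then obtain q where "b = 2 * q" by blast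
          then have "b ^ 2 = 4 * (q * q)" by (simp add: power2_eq_square)
          then show ?thesis by presburger
        next
          case False
          then obtain q where "b = 2 * q + 1" by (elim oddE)
          then have "b ^ 2 = 4 * (q * q + q) + 1" by (simp add: power2_eq_square)
          then show ?thesis by presburger
        qed
        ultimately show ?thesis by blast
      qed
    qed
    have yx': "inv y \<otimes> x = inv x \<otimes> inv y"
    proof -
      have "inv y \<otimes> x = inv y \<otimes> (x \<otimes> (y \<otimes> x)) \<otimes> inv x \<otimes> inv y"
        using x y(1) by (simp add: m_assoc)
      also have "x \<otimes> (y \<otimes> x) = y" unfolding yx using x y(1) by simp
      finally show ?thesis using x y(1) by simp
    qed
    \<comment> \<open>Both \<open>g\<close> and \<open>y\<close> invert \<open>x\<close>, so the
      quotient centralizes \<open>x\<close>.\<close>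
    have coset: "g \<otimes> inv y \<in> ?A" if g: "g \<in> carrier G" "g \<notin> ?A" for g
    proof (rule cent)
      have "(g \<otimes> inv y) \<otimes> x = (g \<otimes> inv x) \<otimes> inv y"
        using g x y(1) yx' by (simp add: m_assoc)
      also have "g \<otimes> inv x = x \<otimes> g"
      proof -
        have "g \<otimes> inv x = x \<otimes> (inv x \<otimes> g) \<otimes> inv x" using g x by simp
        also have "inv x \<otimes> g = g \<otimes> x" using inverts[OF g] by simp
        finally show ?thesis using g x by (simp add: m_assoc)
      qed
      finally show "g \<otimes> inv y \<otimes> x = x \<otimes> (g \<otimes> inv y)" using g x y(1) by (simp add: m_assoc)
    qed (use g y in simp)
    have union: "carrier G \<subseteq> ?A \<union> (\<lambda>a. a \<otimes> y) ` ?A"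
    proof
      fix g assume g: "g \<in> carrier G"
      show "g \<in> ?A \<union> (\<lambda>a. a \<otimes> y) ` ?A"
      proof (cases "g \<in> ?A")
        case False
        have "g = (g \<otimes> inv y) \<otimes> y" using g y by (simp add: m_assoc)
        then show ?thesis using coset[OF g False] by blast
      qed simp
    qed
    have finA: "finite ?A" using A.subset fin by (rule finite_subset)
    have cardA: "card ?A = 2 ^ n" using generate_pow_card[OF x] n by simp
    \<comment> \<open>Two cosets bound the order by \<open>2 ^ (n + 1)\<close>, the element
      \<open>y\<close> makes it exceed \<open>2 ^ n\<close>, and it is a power of 2. The
      \<open>k\<close> of the quaternion presentation is thus \<open>n + 1\<close>.\<close>
    have "order G = 2 ^ (n + 1)"
    proof -
      have "order G \<le> card (?A \<union> (\<lambda>a. a \<otimes> y) ` ?A)"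
        unfolding order_def using finA union by (intro card_mono) auto
      also have "\<dots> \<le> 2 ^ n + 2 ^ n"
        using card_Un_le[of ?A "(\<lambda>a. a \<otimes> y) ` ?A"] card_image_le[OF finA, of "\<lambda>a. a \<otimes> y"] cardA by simp
      finally have "(2::nat) ^ N \<le> 2 ^ (n + 1)" using ord p2 by simp
      then have "N \<le> n + 1" by (rule power_le_imp_le_exp[rotated]) simp
      have "card ?A < order G"
        unfolding order_def using fin A.subset y by (intro psubset_card_mono) auto
      then have "(2::nat) ^ n < 2 ^ N" using ord p2 cardA by simp
      then have "n < N" by (rule power_less_imp_less_exp[rotated]) simp
      then have "N = n + 1" using \<open>N \<le> n + 1\<close> by simp
      then show ?thesis using ord p2 by simp
    qed
    moreover have "generate G {x, y} = carrier G"
    proof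
      show "generate G {x, y} \<subseteq> carrier G" using x y by (intro generate_incl) simp
      have "?A \<subseteq> generate G {x, y}" by (rule mono_generate) simp
      moreover have "y \<in> generate G {x, y}" by (simp add: generate.incl)
      ultimately show "carrier G \<subseteq> generate G {x, y}" using union by (auto intro!: generate.eng)
    qed
    moreover have "x [^] (2 ^ (n + 1 - 1) :: nat) = \<one>" using x n(2) by (simp add: pow_eq_id)
    moreover have "x [^] (2 ^ (n + 1 - 2) :: nat) = y [^] (2::nat)" using n(3) by simp
    moreover have "y \<otimes> x \<otimes> inv y = inv x" using x y(1) unfolding yx by (simp add: m_assoc)
    moreover have "n + 1 \<ge> 3" using n(1) by simp
    ultimately have "generalized_quaternion_group G"
      unfolding generalized_quaternion_group_def using x y(1) is_group by blast
    then show ?thesis by blast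
  qed
qed

end

section \<open>Dominating vertices\<close>

text \<open>For a prime \<open>p\<close> dividing the order of \<open>u\<close> in a finite group,
  this is the unique subgroup of order \<open>p\<close> in the cyclic group generated by
  \<open>u\<close>.\<close>

definition prime_torsion :: "('a, 'b) monoid_scheme \<Rightarrow> nat \<Rightarrow> 'a \<Rightarrow> 'a set" where
  "prime_torsion G p u = {v \<in> generate G {u}. v [^]\<^bsub>G\<^esub> p = \<one>\<^bsub>G\<^esub>}"

text \<open>The inclusion in \<open>H\<close> is part of the induction so that commutators and
  generated subgroups formed inside \<open>H\<close> agree with those formed in
  \<open>G\<close>.\<close>

lemma (in group) lower_central_series_subgroup:
  assumes H: "subgroup H G"
  shows "lower_central_series (G\<lparr>carrier := H\<rparr>) n \<subseteq> H \<inter> lower_central_series G n"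
proof (induction n)
  case 0
  then show ?case using subgroup.subset[OF H] by auto
next
  case (Suc n)
  let ?comm = "\<lambda>S T. \<Union>x \<in> S. \<Union>y \<in> T. {x \<otimes> y \<otimes> inv x \<otimes> inv y}"
  interpret H: subgroup H G by (rule H)
  let ?L = "lower_central_series (G\<lparr>carrier := H\<rparr>) n"
  have eq: "lower_central_series (G\<lparr>carrier := H\<rparr>) (Suc n) = generate (G\<lparr>carrier := H\<rparr>) (?comm ?L H)"
    using Suc H by (auto intro!: arg_cong[where f = "generate _"] simp: subset_iff)
  have sub: "?comm ?L H \<subseteq> H" using Suc by auto
  have "generate (G\<lparr>carrier := H\<rparr>) (?comm ?L H) = generate G (?comm ?L H)"
    using sub H by (rule generate_consistent)
  moreover have "generate G (?comm ?L H) \<subseteq> H" using sub H by (rule generate_subgroup_incl)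
  moreover have "generate G (?comm ?L H) \<subseteq> lower_central_series G (Suc n)"
    using Suc H.subset by (auto intro!: mono_generate)
  ultimately show ?case unfolding eq by blast
qed

lemma (in group) nilpotent_subgroup:
  assumes nil: "nilpotent_group G" and H: "subgroup H G"
  shows "nilpotent_group (G\<lparr>carrier := H\<rparr>)"
proof -
  obtain n where n: "lower_central_series G n = {\<one>}"
    using nil by (auto simp: nilpotent_group_def)
  have grp: "group (G\<lparr>carrier := H\<rparr>)" using H by (rule subgroup_imp_group)
  have "\<one> \<in> lower_central_series (G\<lparr>carrier := H\<rparr>) n"
    using subgroup.one_closed[OF H] by (cases n) (auto intro: generate.one[of "G\<lparr>carrier := H\<rparr>", simplified])
  then show ?thesis
    using lower_central_series_subgroup[OF H, of n] n grp by (auto simp: nilpotent_group_def)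
qed

section \<open>Subgroups of prime order below a vertex\<close>

context group
begin

lemma prime_torsion_generate:
  assumes fin: "finite (carrier G)" and p: "Factorial_Ring.prime p"
    and u: "u \<in> carrier G" "p dvd ord u"
  shows "prime_torsion G p u = generate G {u [^] (ord u div p)}" (is "_ = generate G {?z}")
    and "card (prime_torsion G p u) = p"
proof -
  obtain m where m: "ord u = p * m" using u by blast
  have p0: "p > 0" using p by (rule prime_gt_0_nat)
  have "ord u > 0" using ord_ge_1[OF fin u(1)] by simp
  then have m0: "m > 0" using m by simp
  have z: "?z = u [^] m" using m p0 by simp
  show eq: "prime_torsion G p u = generate G {?z}"
  proof
    show "generate G {?z} \<subseteq> prime_torsion G p u"
    proof
      fix v assume "v \<in> generate G {?z}"
      then obtain i where "v = (u [^] m) [^] (i::nat)" using fin u by (auto simp: mem_generate_iff z)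
      then have v: "v = u [^] (m * i)" using u by (simp add: nat_pow_pow)
      have "v [^] p = \<one>" using v m u by (simp add: nat_pow_pow pow_eq_id)
      then show "v \<in> prime_torsion G p u"
        using v fin u by (auto simp: prime_torsion_def mem_generate_iff)
    qed
    show "prime_torsion G p u \<subseteq> generate G {?z}"
    proof
      fix v assume v: "v \<in> prime_torsion G p u"
      then obtain i where i: "v = u [^] (i::nat)" using fin u by (auto simp: prime_torsion_def mem_generate_iff)
      then have "u [^] (i * p) = \<one>" using v u by (simp add: prime_torsion_def nat_pow_pow)
      then have "p * m dvd p * i" using u m by (simp add: pow_eq_id mult.commute)
      then have "m dvd i" using p0 by simp
      then obtain k where "i = m * k" by blast
      then have "v = (u [^] m) [^] k" using i u by (simp add: nat_pow_pow)
      then show "v \<in> generate G {?z}" using fin u by (auto simp: mem_generate_iff z)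
    qed
  qed
  have "ord ?z = p" unfolding z using u m m0 p0 by (subst ord_pow) auto
  then show "card (prime_torsion G p u) = p" using eq u by (simp add: generate_pow_card)
qed

lemma prime_torsion_subgroup:
  assumes "finite (carrier G)" "Factorial_Ring.prime p" "u \<in> carrier G" "p dvd ord u"
  shows "subgroup (prime_torsion G p u) G"
  unfolding prime_torsion_generate(1)[OF assms] using assms by (intro generate_is_subgroup) simp

text \<open>One of the two sets contains the other and both have \<open>p\<close> elements. Applied
  to a common cyclic overgroup, this makes \<open>prime_torsion\<close> agree on adjacent vertices
  of order divisible by \<open>p\<close>.\<close>

lemma prime_torsion_eq:
  assumes fin: "finite (carrier G)" and p: "Factorial_Ring.prime p" and w: "w \<in> carrier G"
    and u: "u \<in> generate G {w}" "p dvd ord u"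
  shows "prime_torsion G p u = prime_torsion G p w"
proof -
  have uc: "u \<in> carrier G" using generate_incl[of "{w}"] w u by auto
  have "u [^] ord w = \<one>" using u w fin by (auto simp: mem_generate_iff nat_pow_pow pow_eq_id)
  then have "ord u dvd ord w" using uc by (simp add: pow_eq_id)
  then have "p dvd ord w" using u dvd_trans by blast
  then have "card (prime_torsion G p w) = card (prime_torsion G p u)"
    using prime_torsion_generate(2)[OF fin p] w uc u by simp
  moreover have "prime_torsion G p u \<subseteq> prime_torsion G p w"
    using generate_singleton_mono[OF u(1) w] by (auto simp: prime_torsion_def)
  moreover have "finite (prime_torsion G p w)"
    using generate_incl[of "{w}"] w fin by (auto simp: prime_torsion_def intro: finite_subset)
  ultimately show ?thesis by (metis card_subset_eq)
qed

lemma prime_torsion_of_prime_order: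
  assumes fin: "finite (carrier G)" and p: "Factorial_Ring.prime p" and H: "subgroup H G" "card H = p"
    and h: "h \<in> H" "h \<noteq> \<one>"
  shows "ord h = p" "prime_torsion G p h = H" "generate G {h} = H"
proof -
  interpret H: subgroup H G by (rule H)
  have hc: "h \<in> carrier G" using h H.subset by blast
  have sub: "generate G {h} \<subseteq> H" using h H by (intro generate_subgroup_incl) auto
  have pow: "v [^] p = \<one>" if "v \<in> H" for v
  proof -
    have "v [^]\<^bsub>G\<lparr>carrier := H\<rparr>\<^esub> order (G\<lparr>carrier := H\<rparr>) = \<one>\<^bsub>G\<lparr>carrier := H\<rparr>\<^esub>"
      using subgroup_imp_group[OF H(1)] that by (intro group.pow_order_eq_1) auto
    then show ?thesis using H by (simp add: order_def nat_pow_consistent[symmetric])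
  qed
  then have "ord h dvd p" using h hc by (simp add: pow_eq_id[symmetric])
  moreover have "ord h \<noteq> 1" using hc h ord_eq_1 by blast
  ultimately show o: "ord h = p" using p prime_nat_iff by blast
  have "finite H" using H.subset fin by (rule finite_subset)
  then show gen: "generate G {h} = H"
    using sub o H(2) generate_pow_card[OF hc] by (metis card_subset_eq)
  then show "prime_torsion G p h = H" using pow by (auto simp: prime_torsion_def)
qed

lemma exists_nontrivial_of_prime_card:
  assumes p: "Factorial_Ring.prime p" and H: "subgroup H G" "card H = p"
  shows "\<exists>h \<in> H. h \<noteq> \<one>"
proof (rule ccontr)
  assume "\<not> ?thesis"
  then have "H \<subseteq> {\<one>}" by blast
  then have "card H \<le> 1" using card_mono[of "{\<one>}" H] by simp
  then show False using H prime_gt_1_nat[OF p] by simp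
qed

lemma proper_enhanced_adj_iff:
  "u \<rightarrow>\<^bsub>proper_enhanced_power_graph G\<^esub> v \<longleftrightarrow>
     u \<in> verts (proper_enhanced_power_graph G) \<and> v \<in> verts (proper_enhanced_power_graph G) \<and>
     u \<noteq> v \<and> (\<exists>w \<in> carrier G. u \<in> generate G {w} \<and> v \<in> generate G {w})"
proof -
  have "(u, v) \<in> arcs_ends (proper_enhanced_power_graph G) \<longleftrightarrow>
      (u, v) \<in> arcs (proper_enhanced_power_graph G)"
    by (simp add: proper_enhanced_power_graph_def enhanced_power_graph_def arcs_ends_conv)
  then show ?thesis
    by (auto simp: proper_enhanced_power_graph_def enhanced_power_graph_def)
qed

lemma dominating_enhanced_common_cyclic:
  assumes v: "v \<in> dominating_vertices (enhanced_power_graph G)" and u: "u \<in> carrier G"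
  shows "\<exists>w \<in> carrier G. u \<in> generate G {w} \<and> v \<in> generate G {w}"
proof (cases "u = v")
  case True
  then show ?thesis using u by (auto intro: generate.incl)
next
  case False
  then have "v \<rightarrow>\<^bsub>enhanced_power_graph G\<^esub> u"
    using v u by (auto simp: dominating_vertices_def enhanced_power_graph_def)
  then show ?thesis by (auto simp: enhanced_power_graph_def arcs_ends_conv)
qed

lemma dominating_enhanced_trivial:
  assumes fin: "finite (carrier G)" and nil: "nilpotent_group G"
    and syl: "\<And>q Q. \<lbrakk>Factorial_Ring.prime q; q dvd order G; sylow_subgroup G q Q\<rbrakk> \<Longrightarrow>
           \<not> cyclic_group (G\<lparr>carrier := Q\<rparr>) \<and> \<not> generalized_quaternion_group (G\<lparr>carrier := Q\<rparr>)"
  shows "dominating_vertices (enhanced_power_graph G) = {\<one>}"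
proof (rule ccontr)
  assume "\<not> ?thesis"
  then obtain v where v: "v \<in> dominating_vertices (enhanced_power_graph G)" "v \<noteq> \<one>"
    using one_in_dominating_vertices by blast
  then have vc: "v \<in> carrier G" by (simp add: dominating_vertices_def enhanced_power_graph_def)
  then have "ord v \<noteq> 1" using v ord_eq_1 by blast
  then obtain p where p: "Factorial_Ring.prime p" "p dvd ord v" using prime_factor_nat by blast
  have pG: "p dvd order G" using p(2) ord_dvd_group_order[OF vc] by (rule dvd_trans)
  \<comment> \<open>Every \<open>u\<close> lies in a common cyclic group with \<open>v\<close>, so
    all elements of order divisible by \<open>p\<close> share one subgroup of order
    \<open>p\<close>. A Sylow \<open>p\<close>-subgroup then has only this one.\<close>
  have same: "prime_torsion G p u = prime_torsion G p v" if "u \<in> carrier G" "p dvd ord u" for u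
    using dominating_enhanced_common_cyclic[OF v(1) that(1)] prime_torsion_eq[OF fin p(1)] that p
    by metis
  obtain m where "order G = p ^ multiplicity p (order G) * m" using multiplicity_dvd by (rule dvdE)
  from sylow_thm[OF p(1) is_group this fin]
  obtain Q where Q: "subgroup Q G" "card Q = p ^ multiplicity p (order G)" by blast
  then have Qs: "sylow_subgroup G p Q" using p by (simp add: sylow_subgroup_def)
  interpret Q: subgroup Q G by (rule Q)
  interpret QG: group "G\<lparr>carrier := Q\<rparr>" using Q by (intro subgroup_imp_group)
  have "cyclic_group (G\<lparr>carrier := Q\<rparr>) \<or> generalized_quaternion_group (G\<lparr>carrier := Q\<rparr>)"
  proof (rule QG.unique_prime_order_subgroup_imp)
    show "finite (carrier (G\<lparr>carrier := Q\<rparr>))" using Q.subset fin by (auto intro: finite_subset)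
    show "order (G\<lparr>carrier := Q\<rparr>) = p ^ multiplicity p (order G)" using Q by (simp add: order_def)
    show "nilpotent_group (G\<lparr>carrier := Q\<rparr>)" using nil Q(1) by (rule nilpotent_subgroup)
  next
    fix a b
    assume ab: "a \<in> carrier (G\<lparr>carrier := Q\<rparr>)" "b \<in> carrier (G\<lparr>carrier := Q\<rparr>)"
      "a [^]\<^bsub>G\<lparr>carrier := Q\<rparr>\<^esub> p = \<one>\<^bsub>G\<lparr>carrier := Q\<rparr>\<^esub>" "b [^]\<^bsub>G\<lparr>carrier := Q\<rparr>\<^esub> p = \<one>\<^bsub>G\<lparr>carrier := Q\<rparr>\<^esub>"
      "b \<noteq> \<one>\<^bsub>G\<lparr>carrier := Q\<rparr>\<^esub>"
    then have pows: "a [^] p = \<one>" "b [^] p = \<one>" "b \<noteq> \<one>" and ac: "a \<in> Q" "b \<in> Q"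
      by (simp_all add: nat_pow_consistent[symmetric])
    have dvd: "p dvd ord c" if "c \<in> Q" "c [^] p = \<one>" "c \<noteq> \<one>" for c
    proof -
      have cc: "c \<in> carrier G" using that Q.subset by blast
      have "ord c dvd p" using that cc by (simp add: pow_eq_id)
      moreover have "ord c \<noteq> 1" using that cc ord_eq_1 by blast
      ultimately show ?thesis using p(1) prime_nat_iff by force
    qed
    have "a \<in> generate G {b}"
    proof (cases "a = \<one>")
      case True
      then show ?thesis by (simp add: generate.one)
    next
      case False
      have "a \<in> prime_torsion G p a" using pows by (simp add: prime_torsion_def generate.incl)
      also have "\<dots> = prime_torsion G p b"
        using same[of a] same[of b] dvd False pows ac Q.subset by auto
      finally show ?thesis by (simp add: prime_torsion_def)
    qed
    then show "a \<in> generate (G\<lparr>carrier := Q\<rparr>) {b}"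
      using generate_consistent[of "{b}" Q] ac Q by simp
  qed (rule p)
  then show False using syl[OF p(1) pG Qs] by blast
qed

lemma finite_subgroups_of_card:
  assumes "finite (carrier G)"
  shows "finite {H. subgroup H G \<and> card H = n}"
proof (rule finite_subset)
  show "{H. subgroup H G \<and> card H = n} \<subseteq> Pow (carrier G)" using subgroup.subset by blast
qed (use assms in simp)

end

lemma strong_domination_number_eqI:
  assumes "total_dominating_set \<Gamma> D" "finite D" "card D \<le> n"
    and "\<And>E. \<lbrakk>total_dominating_set \<Gamma> E; finite E\<rbrakk> \<Longrightarrow> n \<le> card E"
  shows "strong_domination_number \<Gamma> = enat n"
  unfolding strong_domination_number_def
proof (rule antisym)
  show "(INF D \<in> {D. total_dominating_set \<Gamma> D \<and> finite D}. enat (card D)) \<le> enat n"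
    using assms by (intro INF_lower2[of D]) auto
  show "enat n \<le> (INF D \<in> {D. total_dominating_set \<Gamma> D \<and> finite D}. enat (card D))"
    using assms by (intro INF_greatest) auto
qed

section \<open>Total domination\<close>

context group
begin

text \<open>Every edge joins vertices with the same \<open>prime_torsion\<close>, so the vertices
  split into one class for each subgroup of order \<open>p\<close>, and each class must be totally
  dominated from within.\<close>

lemma p_group_total_dominating_card_ge:
  fixes p :: nat
  assumes fin: "finite (carrier G)" and p: "Factorial_Ring.prime p" and ord: "order G = p ^ N"
    and dom: "dominating_vertices (enhanced_power_graph G) = {\<one>}"
    and E: "total_dominating_set (proper_enhanced_power_graph G) E" "finite E"
  shows "2 * num_subgroups_of_order G p \<le> card E"
proof -
  let ?\<Gamma> = "proper_enhanced_power_graph G"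
  let ?S = "{H. subgroup H G \<and> card H = p}"
  have verts: "verts ?\<Gamma> = carrier G - {\<one>}" by (simp add: proper_enhanced_power_graph_def dom)
  have adj: "prime_torsion G p u = prime_torsion G p v \<and> u \<noteq> v" if "u \<rightarrow>\<^bsub>?\<Gamma>\<^esub> v" for u v
    using that prime_torsion_eq[OF fin p] prime_dvd_ord_p_group[OF p ord]
    by (simp add: proper_enhanced_adj_iff verts) metis
  \<comment> \<open>A vertex of the class has a neighbour \<open>d\<close> in \<open>E\<close>, and
    \<open>d\<close> itself needs a neighbour \<open>d'\<close> in \<open>E\<close>; both stay in
    the class.\<close>
  have two: "2 \<le> card {d \<in> E. prime_torsion G p d = H}" if "H \<in> ?S" for H
  proof -
    have H: "subgroup H G" "card H = p" using that by auto
    obtain h where h: "h \<in> H" "h \<noteq> \<one>" using exists_nontrivial_of_prime_card[OF p H] by blast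
    have T: "prime_torsion G p h = H" using prime_torsion_of_prime_order[OF fin p H h] by simp
    have "h \<in> verts ?\<Gamma>" using h subgroup.subset[OF H(1)] by (auto simp: verts)
    then obtain d where d: "d \<in> E" "h \<rightarrow>\<^bsub>?\<Gamma>\<^esub> d" using E(1) by (auto simp: total_dominating_set_def)
    then have "d \<in> verts ?\<Gamma>" using E(1) by (auto simp: total_dominating_set_def)
    then obtain d' where d': "d' \<in> E" "d \<rightarrow>\<^bsub>?\<Gamma>\<^esub> d'" using E(1) by (auto simp: total_dominating_set_def)
    have "{d, d'} \<subseteq> {d \<in> E. prime_torsion G p d = H}"
      using adj[OF d(2)] adj[OF d'(2)] T d d' by auto
    then have "card {d, d'} \<le> card {d \<in> E. prime_torsion G p d = H}"
      using E(2) by (intro card_mono) auto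
    then show ?thesis using adj[OF d'(2)] by simp
  qed
  have "2 * card ?S \<le> (\<Sum>H\<in>?S. card {d \<in> E. prime_torsion G p d = H})"
    using sum_bounded_below[of ?S 2 "\<lambda>H. card {d \<in> E. prime_torsion G p d = H}"] two by simp
  also have "\<dots> = card (\<Union>H\<in>?S. {d \<in> E. prime_torsion G p d = H})"
    using finite_subgroups_of_card[OF fin] E(2) by (intro card_UN_disjoint[symmetric]) auto
  also have "\<dots> \<le> card E" using E(2) by (intro card_mono) auto
  finally show ?thesis by (simp add: num_subgroups_of_order_def)
qed

lemma strong_domination_number_p_group:
  fixes p :: nat
  assumes fin: "finite (carrier G)" and p: "Factorial_Ring.prime p" and ord: "order G = p ^ N"
    and dom: "dominating_vertices (enhanced_power_graph G) = {\<one>}"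
    and D: "total_dominating_set (proper_enhanced_power_graph G) D"
  shows "strong_domination_number (proper_enhanced_power_graph G)
           = enat (2 * num_subgroups_of_order G p)"
proof -
  let ?\<Gamma> = "proper_enhanced_power_graph G"
  let ?S = "{H. subgroup H G \<and> card H = p}"
  have verts: "verts ?\<Gamma> = carrier G - {\<one>}" by (simp add: proper_enhanced_power_graph_def dom)
  have finS: "finite ?S" using fin by (rule finite_subgroups_of_card)
  have "\<forall>H\<in>?S. \<exists>h. h \<in> H \<and> h \<noteq> \<one>" using exists_nontrivial_of_prime_card[OF p] by blast
  then obtain f where f: "\<forall>H\<in>?S. f H \<in> H \<and> f H \<noteq> \<one>" by (rule bchoice[THEN exE])
  have fv: "f H \<in> verts ?\<Gamma>" if "H \<in> ?S" for H
    using f that subgroup.subset by (fastforce simp: verts)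
  then have "\<forall>H\<in>?S. \<exists>d. d \<in> D \<and> f H \<rightarrow>\<^bsub>?\<Gamma>\<^esub> d"
    using D unfolding total_dominating_set_def by blast
  \<comment> \<open>The given set \<open>D\<close> supplies a neighbour for each chosen
    \<open>f H\<close>; without one, \<open>f H\<close> would be isolated.\<close>
  then obtain g where g: "\<forall>H\<in>?S. g H \<in> D \<and> f H \<rightarrow>\<^bsub>?\<Gamma>\<^esub> g H" by (rule bchoice[THEN exE])
  show ?thesis
  proof (rule strong_domination_number_eqI)
    show "total_dominating_set ?\<Gamma> (f ` ?S \<union> g ` ?S)"
      unfolding total_dominating_set_def
    proof (intro conjI ballI)
      show "f ` ?S \<union> g ` ?S \<subseteq> verts ?\<Gamma>"
        using fv g D unfolding total_dominating_set_def by blast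
    next
      fix u assume u: "u \<in> verts ?\<Gamma>"
      then have uc: "u \<in> carrier G" "u \<noteq> \<one>" by (auto simp: verts)
      let ?H = "prime_torsion G p u"
      have "p dvd ord u" using p ord uc by (rule prime_dvd_ord_p_group)
      then have H: "?H \<in> ?S"
        using prime_torsion_subgroup[OF fin p uc(1)] prime_torsion_generate(2)[OF fin p uc(1)] by simp
      then have "f ?H \<in> generate G {u}" using f by (auto simp: prime_torsion_def)
      \<comment> \<open>The cyclic group witnessing adjacency is the one generated by
        \<open>u\<close> itself.\<close>
      then have "u = f ?H \<or> u \<rightarrow>\<^bsub>?\<Gamma>\<^esub> f ?H"
        using u uc fv[OF H] by (auto simp: proper_enhanced_adj_iff intro: generate.incl)
      moreover have "f ?H \<rightarrow>\<^bsub>?\<Gamma>\<^esub> g ?H" using bspec[OF g H] by (rule conjunct2)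
      ultimately have "u \<rightarrow>\<^bsub>?\<Gamma>\<^esub> f ?H \<or> u \<rightarrow>\<^bsub>?\<Gamma>\<^esub> g ?H" by metis
      moreover have "f ?H \<in> f ` ?S" "g ?H \<in> g ` ?S" using H by (rule imageI)+
      ultimately show "\<exists>v\<in>f ` ?S \<union> g ` ?S. u \<rightarrow>\<^bsub>?\<Gamma>\<^esub> v" by blast
    qed
    show "finite (f ` ?S \<union> g ` ?S)" using finS by simp
    show "card (f ` ?S \<union> g ` ?S) \<le> 2 * num_subgroups_of_order G p"
      using card_Un_le[of "f ` ?S" "g ` ?S"] card_image_le[OF finS, of f] card_image_le[OF finS, of g]
      by (simp add: num_subgroups_of_order_def)
  qed (rule p_group_total_dominating_card_ge[OF fin p ord dom])
qed

section \<open>Products of elements of coprime orders\<close>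

text \<open>An exponent that is a multiple of \<open>ord y\<close> and 1 modulo \<open>ord x\<close>
  extracts \<open>x\<close> from the product.\<close>

lemma coprime_orders_mem_generate_mult:
  assumes fin: "finite (carrier G)" and x: "x \<in> carrier G" and y: "y \<in> carrier G"
    and xy: "x \<otimes> y = y \<otimes> x" and cop: "coprime (ord x) (ord y)"
  shows "x \<in> generate G {x \<otimes> y}"
proof -
  obtain i where i: "[ord y * i = 1] (mod ord x)"
    using cong_solve_coprime_nat[of "ord y" "ord x"] cop by (auto simp: coprime_commute)
  have "(x \<otimes> y) [^] (ord y * i) = x [^] (ord y * i) \<otimes> y [^] (ord y * i)"
    using xy x y by (rule pow_mult_distrib)
  also have "x [^] (ord y * i) = x [^] (1::nat)" using i by (simp only: pow_eq_iff_cong[OF x])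
  also have "y [^] (ord y * i) = \<one>" using y by (simp add: pow_eq_id)
  finally have "x = (x \<otimes> y) [^] (ord y * i)" using x by simp
  then show ?thesis using fin x y by (auto simp: mem_generate_iff)
qed

text \<open>The root is the product of the \<open>h j\<close>. The bound on its order is carried
  through the induction to keep the next factor of coprime order.\<close>

lemma exists_common_root:
  fixes p :: "'i \<Rightarrow> nat"
  assumes fin: "finite (carrier G)"
    and comm: "\<And>x y. \<lbrakk>x \<in> carrier G; y \<in> carrier G; coprime (ord x) (ord y)\<rbrakk> \<Longrightarrow> x \<otimes> y = y \<otimes> x"
    and J: "finite J" "inj_on p J" "\<And>j. j \<in> J \<Longrightarrow> Factorial_Ring.prime (p j)"
    and h: "\<And>j. j \<in> J \<Longrightarrow> h j \<in> carrier G \<and> ord (h j) = p j"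
  shows "\<exists>u \<in> carrier G. ord u dvd (\<Prod>j\<in>J. p j) \<and> (\<forall>j\<in>J. h j \<in> generate G {u})"
  using J h
proof (induction J)
  case empty
  then show ?case by (intro bexI[of _ \<one>]) auto
next
  case (insert k J)
  then obtain u where u: "u \<in> carrier G" "ord u dvd (\<Prod>j\<in>J. p j)" "\<And>j. j \<in> J \<Longrightarrow> h j \<in> generate G {u}"
    by (auto simp: inj_on_insert)
  have hk: "h k \<in> carrier G" "ord (h k) = p k" using insert.prems by auto
  have "coprime (\<Prod>j\<in>J. p j) (p k)"
  proof (rule prod_coprime_left)
    fix j assume "j \<in> J"
    then have "p j \<noteq> p k" using insert.hyps insert.prems(1) by (auto simp: inj_on_def)
    then show "coprime (p j) (p k)" using insert.prems(2) \<open>j \<in> J\<close> by (intro primes_coprime) auto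
  qed
  then have cop: "coprime (ord u) (ord (h k))"
    using u(2) hk by (auto elim: coprime_divisors)
  then have com: "u \<otimes> h k = h k \<otimes> u" using u hk by (intro comm)
  have uu: "u \<in> generate G {u \<otimes> h k}" by (rule coprime_orders_mem_generate_mult[OF fin u(1) hk(1) com cop])
  have "h k \<in> generate G {h k \<otimes> u}"
    using cop by (intro coprime_orders_mem_generate_mult[OF fin hk(1) u(1) com[symmetric]]) (simp add: coprime_commute)
  then have "h k \<in> generate G {u \<otimes> h k}" using com by simp
  moreover have "generate G {u} \<subseteq> generate G {u \<otimes> h k}" using uu u hk by (intro generate_singleton_mono) auto
  moreover have "ord (u \<otimes> h k) dvd (\<Prod>j\<in>insert k J. p j)"
    using ord_mul_divides[OF com u(1) hk(1)] u(2) hk insert.hyps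
    by (simp add: mult.commute) (metis dvd_trans dvd_refl mult_dvd_mono mult.commute)
  ultimately show ?case using u hk by (intro bexI[of _ "u \<otimes> h k"]) auto
qed

end

section \<open>Direct products of Sylow subgroups\<close>

text \<open>The decomposition enters through jointly injective coordinate homomorphisms
  \<open>q i\<close> into \<open>P i\<close>. They come from an abstract isomorphism, so
  \<open>q i\<close> need not fix \<open>P i\<close> pointwise.\<close>

locale sylow_product = group G for G :: "('a, 'b) monoid_scheme" (structure) +
  fixes I :: "'i set" and p :: "'i \<Rightarrow> nat" and P :: "'i \<Rightarrow> 'a set" and q :: "'i \<Rightarrow> 'a \<Rightarrow> 'a"
  assumes fin: "finite (carrier G)" and finI: "finite I" and inj_p: "inj_on p I"
    and primes: "p ` I = {r. Factorial_Ring.prime r \<and> r dvd order G}"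
    and sylow: "i \<in> I \<Longrightarrow> sylow_subgroup G (p i) (P i)"
    and proj_hom: "i \<in> I \<Longrightarrow> q i \<in> hom G G"
    and proj_mem: "i \<in> I \<Longrightarrow> x \<in> carrier G \<Longrightarrow> q i x \<in> P i"
    and proj_inj: "x \<in> carrier G \<Longrightarrow> y \<in> carrier G \<Longrightarrow> (\<And>i. i \<in> I \<Longrightarrow> q i x = q i y) \<Longrightarrow> x = y"
begin

lemma prime_p: "i \<in> I \<Longrightarrow> Factorial_Ring.prime (p i)"
  and p_dvd_order: "i \<in> I \<Longrightarrow> p i dvd order G"
  using primes by blast+

lemma ord_sylow:
  assumes "i \<in> I" "x \<in> P i"
  shows "ord x dvd p i ^ multiplicity (p i) (order G)"
proof -
  have P: "subgroup (P i) G" "card (P i) = p i ^ multiplicity (p i) (order G)"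
    using sylow[OF assms(1)] by (auto simp: sylow_subgroup_def)
  have "x [^]\<^bsub>G\<lparr>carrier := P i\<rparr>\<^esub> order (G\<lparr>carrier := P i\<rparr>) = \<one>\<^bsub>G\<lparr>carrier := P i\<rparr>\<^esub>"
    using subgroup_imp_group[OF P(1)] assms(2) by (intro group.pow_order_eq_1) auto
  then have "x [^] (p i ^ multiplicity (p i) (order G)) = \<one>"
    using P by (simp add: order_def nat_pow_consistent[symmetric])
  moreover have "x \<in> carrier G" using assms P subgroup.subset by blast
  ultimately show ?thesis by (simp add: pow_eq_id)
qed

text \<open>The order of \<open>q i x\<close> divides both \<open>ord x\<close> and a power of
  \<open>p i\<close>, which are coprime.\<close>

lemma proj_trivial:
  assumes i: "i \<in> I" and x: "x \<in> carrier G" and ndvd: "\<not> p i dvd ord x"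
  shows "q i x = \<one>"
proof -
  interpret h: group_hom G G "q i" using proj_hom[OF i] by unfold_locales
  have "q i x [^] ord x = q i (x [^] ord x)" using h.hom_nat_pow[OF x] by simp
  also have "\<dots> = \<one>" using pow_ord_eq_1[OF x] by simp
  finally have dvd: "ord (q i x) dvd ord x" using x by (simp add: pow_eq_id)
  have "coprime (ord x) (p i ^ multiplicity (p i) (order G))"
    using prime_imp_coprime[OF prime_p[OF i] ndvd] by (simp add: coprime_commute)
  then have "coprime (ord (q i x)) (ord (q i x))"
    by (rule coprime_divisors[OF dvd ord_sylow[OF i proj_mem[OF i x]]])
  then have "ord (q i x) = 1" by simp
  then show ?thesis using ord_eq_1[OF h.hom_closed[OF x]] by simp
qed

text \<open>In every coordinate at least one of the two elements is trivial.\<close>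

lemma coprime_orders_commute:
  assumes x: "x \<in> carrier G" and y: "y \<in> carrier G" and cop: "coprime (ord x) (ord y)"
  shows "x \<otimes> y = y \<otimes> x"
proof (rule proj_inj)
  fix i assume i: "i \<in> I"
  interpret h: group_hom G G "q i" using proj_hom[OF i] by unfold_locales
  have "\<not> p i dvd ord x \<or> \<not> p i dvd ord y"
    using cop prime_p[OF i] by (metis coprime_common_divisor_nat not_prime_1)
  then have "q i x = \<one> \<or> q i y = \<one>" using proj_trivial[OF i] x y by blast
  then show "q i (x \<otimes> y) = q i (y \<otimes> x)" using x y by auto
qed (use x y in simp_all)

text \<open>Let \<open>N\<close> consist of the elements whose coordinates other than
  \<open>i\<close> vanish. It contains all elements of \<open>p i\<close>-power order, in particular
  \<open>P i\<close>, and \<open>q i\<close> embeds it into \<open>P i\<close>; counting gives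
  \<open>N = P i\<close>.\<close>

lemma mem_sylow_of_ord:
  assumes i: "i \<in> I" and x: "x \<in> carrier G" and ord: "ord x dvd p i ^ k"
  shows "x \<in> P i"
proof -
  define N where "N = {x \<in> carrier G. \<forall>j \<in> I - {i}. q j x = \<one>}"
  have mem: "x \<in> N" if x: "x \<in> carrier G" and ord: "ord x dvd p i ^ k" for x k
  proof -
    have "q j x = \<one>" if j: "j \<in> I - {i}" for j
    proof (rule proj_trivial)
      show "\<not> p j dvd ord x"
      proof
        assume "p j dvd ord x"
        then have "p j dvd p i ^ k" using ord by (rule dvd_trans)
        then have "p j dvd p i" using prime_dvd_power prime_p j by blast
        then have "p j = p i" using primes_dvd_imp_eq prime_p i j by blast
        then show False using inj_p i j by (auto simp: inj_on_def)
      qed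
    qed (use j x in auto)
    then show ?thesis using x by (simp add: N_def)
  qed
  have finP: "finite (P i)" and subP: "P i \<subseteq> carrier G"
    using sylow[OF i] fin subgroup.subset by (auto simp: sylow_subgroup_def intro: finite_subset)
  have "inj_on (q i) N"
  proof (rule inj_onI)
    fix x y assume xy: "x \<in> N" "y \<in> N" "q i x = q i y"
    show "x = y"
    proof (rule proj_inj)
      fix j assume "j \<in> I"
      then show "q j x = q j y" using xy by (cases "j = i") (auto simp: N_def)
    qed (use xy in \<open>auto simp: N_def\<close>)
  qed
  then have "card N \<le> card (P i)"
    using finP proj_mem[OF i] by (intro card_inj_on_le) (auto simp: N_def)
  moreover have "P i \<subseteq> N" using ord_sylow[OF i] subP mem by blast
  moreover have "finite N" using fin by (simp add: N_def)
  ultimately have "P i = N" by (intro card_seteq)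
  then show ?thesis using mem[OF x ord] by simp
qed

lemma num_subgroups_sylow:
  assumes i: "i \<in> I"
  shows "num_subgroups_of_order (G\<lparr>carrier := P i\<rparr>) (p i) = num_subgroups_of_order G (p i)"
proof -
  have P: "subgroup (P i) G" using sylow[OF i] by (simp add: sylow_subgroup_def)
  have "subgroup H (G\<lparr>carrier := P i\<rparr>) \<longleftrightarrow> subgroup H G" if "card H = p i" for H
  proof
    assume H: "subgroup H G"
    have "x \<in> P i" if x: "x \<in> H" for x
    proof -
      have "x = \<one> \<or> ord x = p i"
        using prime_torsion_of_prime_order(1)[OF fin prime_p[OF i] H \<open>card H = p i\<close> x] by blast
      then have "ord x dvd p i ^ 1" by auto
      then show ?thesis using mem_sylow_of_ord[OF i] subgroup.subset[OF H] x by blast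
    qed
    then show "subgroup H (G\<lparr>carrier := P i\<rparr>)" using H P by (intro subgroup_incl) auto
  qed (rule incl_subgroup[OF P])
  then show ?thesis unfolding num_subgroups_of_order_def by (metis (no_types, lifting))
qed

lemma exists_prime_subgroup:
  assumes i: "i \<in> I"
  shows "\<exists>H. subgroup H G \<and> card H = p i"
proof -
  obtain m where "order G = p i ^ 1 * m" using p_dvd_order[OF i] by auto
  from sylow_thm[OF prime_p[OF i] is_group this fin] show ?thesis by simp
qed

text \<open>Take a generator \<open>f H\<close> of each subgroup of order \<open>p i\<close> and one
  \<open>z\<close> of order \<open>p j\<close>. A vertex of order prime to \<open>p i\<close> is
  adjacent to every \<open>f H\<close>. Any other vertex is adjacent to the \<open>f H\<close> among
  its powers, or equals it and is adjacent to \<open>z\<close>.\<close>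

lemma exists_total_dominating_set:
  assumes dom: "dominating_vertices (enhanced_power_graph G) = {\<one>}"
    and i: "i \<in> I" and j: "j \<in> I" "j \<noteq> i"
  shows "\<exists>D. total_dominating_set (proper_enhanced_power_graph G) D \<and> finite D \<and>
             card D \<le> num_subgroups_of_order G (p i) + 1"
proof -
  let ?\<Gamma> = "proper_enhanced_power_graph G"
  let ?S = "{H. subgroup H G \<and> card H = p i}"
  have verts: "verts ?\<Gamma> = carrier G - {\<one>}" by (simp add: proper_enhanced_power_graph_def dom)
  have finS: "finite ?S" using fin by (rule finite_subgroups_of_card)
  have "\<forall>H\<in>?S. \<exists>h. h \<in> H \<and> h \<noteq> \<one>" using exists_nontrivial_of_prime_card[OF prime_p[OF i]] by blast
  then obtain f where f: "\<forall>H\<in>?S. f H \<in> H \<and> f H \<noteq> \<one>" by (rule bchoice[THEN exE])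
  have fv: "f H \<in> verts ?\<Gamma>" if "H \<in> ?S" for H
    using f that subgroup.subset by (fastforce simp: verts)
  have fo: "ord (f H) = p i" if "H \<in> ?S" for H
    using prime_torsion_of_prime_order(1)[OF fin prime_p[OF i], of H "f H"] f that by simp
  obtain K where K: "subgroup K G" "card K = p j" using exists_prime_subgroup[OF j(1)] by blast
  obtain z where z: "z \<in> K" "z \<noteq> \<one>" using exists_nontrivial_of_prime_card[OF prime_p[OF j(1)] K] by blast
  have zo: "ord z = p j" using prime_torsion_of_prime_order(1)[OF fin prime_p[OF j(1)] K z] .
  have zv: "z \<in> verts ?\<Gamma>" using z K subgroup.subset by (auto simp: verts)
  have "p i \<noteq> p j" using inj_p i j by (auto simp: inj_on_def)
  then have cop_pj: "coprime (p i) (p j)" using prime_p i j by (intro primes_coprime) auto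
  have adj: "u \<rightarrow>\<^bsub>?\<Gamma>\<^esub> v" if uv: "u \<in> verts ?\<Gamma>" "v \<in> verts ?\<Gamma>" "coprime (ord u) (ord v)" for u v
  proof -
    have c: "u \<in> carrier G" "v \<in> carrier G" and "u \<noteq> \<one>" using uv by (auto simp: verts)
    then have "ord u \<noteq> 1" using ord_eq_1 by blast
    then have "u \<noteq> v" using uv by auto
    have com: "u \<otimes> v = v \<otimes> u" using c uv(3) by (rule coprime_orders_commute)
    have "u \<in> generate G {u \<otimes> v}" using fin c com uv(3) by (rule coprime_orders_mem_generate_mult)
    moreover have "v \<in> generate G {v \<otimes> u}"
      using fin c(2,1) com[symmetric] uv(3)[unfolded coprime_commute[of "ord u"]]
      by (rule coprime_orders_mem_generate_mult)
    ultimately show ?thesis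
      using c uv \<open>u \<noteq> v\<close> com by (auto simp: proper_enhanced_adj_iff intro!: bexI[of _ "u \<otimes> v"])
  qed
  have "total_dominating_set ?\<Gamma> (insert z (f ` ?S))"
    unfolding total_dominating_set_def
  proof (intro conjI ballI)
    show "insert z (f ` ?S) \<subseteq> verts ?\<Gamma>" using fv zv by blast
  next
    fix u assume u: "u \<in> verts ?\<Gamma>"
    then have uc: "u \<in> carrier G" "u \<noteq> \<one>" by (auto simp: verts)
    show "\<exists>v\<in>insert z (f ` ?S). u \<rightarrow>\<^bsub>?\<Gamma>\<^esub> v"
    proof (cases "p i dvd ord u")
      case True
      let ?H = "prime_torsion G (p i) u"
      have H: "?H \<in> ?S"
        using prime_torsion_subgroup[OF fin prime_p[OF i] uc(1) True]
          prime_torsion_generate(2)[OF fin prime_p[OF i] uc(1) True] by simp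
      then have fH: "f ?H \<in> generate G {u}" using f by (auto simp: prime_torsion_def)
      show ?thesis
      proof (cases "u = f ?H")
        case True
        then have "ord u = p i" using fo[OF H] by simp
        then have "u \<rightarrow>\<^bsub>?\<Gamma>\<^esub> z" using u zv zo cop_pj by (intro adj) auto
        then show ?thesis by blast
      next
        case False
        then have "u \<rightarrow>\<^bsub>?\<Gamma>\<^esub> f ?H"
          using u uc fv[OF H] fH by (auto simp: proper_enhanced_adj_iff intro: generate.incl)
        then show ?thesis using H by blast
      qed
    next
      case False
      obtain H where H: "H \<in> ?S" using exists_prime_subgroup[OF i] by blast
      have "coprime (ord u) (ord (f H))"
        using prime_imp_coprime[OF prime_p[OF i] False] fo[OF H] by (simp add: coprime_commute)
      then have "u \<rightarrow>\<^bsub>?\<Gamma>\<^esub> f H" using u fv[OF H] by (intro adj)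
      then show ?thesis using H by blast
    qed
  qed
  moreover have "card (insert z (f ` ?S)) \<le> num_subgroups_of_order G (p i) + 1"
    using card_insert_le_m1[of "num_subgroups_of_order G (p i) + 1" "f ` ?S" z] card_image_le[OF finS, of f]
    by (simp add: num_subgroups_of_order_def)
  ultimately show ?thesis using finS by blast
qed

lemma total_dominating_set_card_gt:
  assumes dom: "dominating_vertices (enhanced_power_graph G) = {\<one>}" and "I \<noteq> {}"
    and D: "total_dominating_set (proper_enhanced_power_graph G) D" "finite D"
  shows "\<exists>i \<in> I. num_subgroups_of_order G (p i) < card D"
proof (rule ccontr)
  assume neg: "\<not> ?thesis"
  let ?\<Gamma> = "proper_enhanced_power_graph G"
  let ?S = "\<lambda>i. {H. subgroup H G \<and> card H = p i}"
  let ?T = "\<lambda>i d. prime_torsion G (p i) d"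
  have verts: "verts ?\<Gamma> = carrier G - {\<one>}" by (simp add: proper_enhanced_power_graph_def dom)
  have D_verts: "D \<subseteq> verts ?\<Gamma>" and D_dom: "\<And>u. u \<in> verts ?\<Gamma> \<Longrightarrow> \<exists>d\<in>D. u \<rightarrow>\<^bsub>?\<Gamma>\<^esub> d"
    using D(1) by (auto simp: total_dominating_set_def)
  have adj: "?T i u = ?T i v" if "u \<rightarrow>\<^bsub>?\<Gamma>\<^esub> v" "i \<in> I" "p i dvd ord u" "p i dvd ord v" for u v i
    using that prime_torsion_eq[OF fin prime_p[OF that(2)]] by (simp add: proper_enhanced_adj_iff) metis
  have "\<forall>d\<in>D. \<exists>i. i \<in> I \<and> p i dvd ord d"
  proof
    fix d assume "d \<in> D"
    then have d: "d \<in> carrier G" "d \<noteq> \<one>" using D_verts by (auto simp: verts)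
    then have "ord d \<noteq> 1" using ord_eq_1 by blast
    then obtain r where r: "Factorial_Ring.prime r" "r dvd ord d" using prime_factor_nat by blast
    have "r dvd order G" using r(2) ord_dvd_group_order[OF d(1)] by (rule dvd_trans)
    then have "r \<in> p ` I" unfolding primes using r(1) by simp
    then show "\<exists>i. i \<in> I \<and> p i dvd ord d" using r(2) by blast
  qed
  then obtain f where f: "\<forall>d\<in>D. f d \<in> I \<and> p (f d) dvd ord d" by (rule bchoice[THEN exE])
  \<comment> \<open>If nothing were missed, the counts of \<open>D\<close>, of the subgroups of
    order \<open>p i\<close> and of the \<open>d\<close> assigned to \<open>i\<close> would
    coincide. Then all of \<open>D\<close> is assigned to \<open>i\<close> and \<open>?T i\<close>
    is injective on \<open>D\<close>, contradicting two adjacent members of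
    \<open>D\<close>.\<close>
  have missed: "\<exists>H. H \<in> ?S i \<and> H \<notin> ?T i ` {d \<in> D. f d = i}" if i: "i \<in> I" for i
  proof (rule ccontr)
    assume "\<not> ?thesis"
    then have "?S i \<subseteq> ?T i ` {d \<in> D. f d = i}" by blast
    then have "card (?S i) \<le> card (?T i ` {d \<in> D. f d = i})" using D(2) by (intro card_mono) auto
    moreover have "card D \<le> card (?S i)" using neg i by (auto simp: num_subgroups_of_order_def)
    moreover have "card (?T i ` {d \<in> D. f d = i}) \<le> card {d \<in> D. f d = i}"
      using D(2) by (intro card_image_le) auto
    moreover have "card {d \<in> D. f d = i} \<le> card D" using D(2) by (intro card_mono) auto
    ultimately have cD: "card {d \<in> D. f d = i} = card D"
      and cT: "card (?T i ` {d \<in> D. f d = i}) = card {d \<in> D. f d = i}" by linarith+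
    have eqD: "{d \<in> D. f d = i} = D" using D(2) cD by (intro card_subset_eq) auto
    then have inj: "inj_on (?T i) D" using cT D(2) by (simp add: eq_card_imp_inj_on)
    obtain K where K: "subgroup K G" "card K = p i" using exists_prime_subgroup[OF i] by blast
    then obtain z where z: "z \<in> K" "z \<noteq> \<one>" using exists_nontrivial_of_prime_card[OF prime_p[OF i] K] by blast
    then have "z \<in> verts ?\<Gamma>" using K subgroup.subset by (auto simp: verts)
    then obtain d where d: "d \<in> D" using D_dom by blast
    then obtain d' where d': "d' \<in> D" "d \<rightarrow>\<^bsub>?\<Gamma>\<^esub> d'" using D_dom D_verts by blast
    have "d \<in> {d \<in> D. f d = i}" "d' \<in> {d \<in> D. f d = i}" using d d'(1) eqD by simp_all
    then have "p i dvd ord d" "p i dvd ord d'" using f by auto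
    then have "?T i d = ?T i d'" using adj d' i by blast
    then have "d = d'" using inj d d' by (simp add: inj_on_def)
    then show False using d' by (simp add: proper_enhanced_adj_iff)
  qed
  then have "\<forall>i\<in>I. \<exists>H. H \<in> ?S i \<and> H \<notin> ?T i ` {d \<in> D. f d = i}" by blast
  then obtain F where F: "\<forall>i\<in>I. F i \<in> ?S i \<and> F i \<notin> ?T i ` {d \<in> D. f d = i}" by (rule bchoice[THEN exE])
  have "\<forall>i\<in>I. \<exists>h. h \<in> F i \<and> h \<noteq> \<one>"
  proof
    fix i assume i: "i \<in> I"
    then have "subgroup (F i) G" "card (F i) = p i" using F by auto
    then show "\<exists>h. h \<in> F i \<and> h \<noteq> \<one>"
      using exists_nontrivial_of_prime_card[OF prime_p[OF i]] by blast
  qed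
  then obtain h where h: "\<forall>i\<in>I. h i \<in> F i \<and> h i \<noteq> \<one>" by (rule bchoice[THEN exE])
  have hT: "ord (h i) = p i" "?T i (h i) = F i" "h i \<in> carrier G" if "i \<in> I" for i
    using prime_torsion_of_prime_order[OF fin prime_p[OF that], of "F i" "h i"] F h that
      subgroup.subset[of "F i" G] by auto
  have "\<exists>u \<in> carrier G. ord u dvd (\<Prod>i\<in>I. p i) \<and> (\<forall>i\<in>I. h i \<in> generate G {u})"
    by (rule exists_common_root[OF fin coprime_orders_commute finI inj_p prime_p]) (use hT in auto)
  then obtain u where u: "u \<in> carrier G" "\<And>i. i \<in> I \<Longrightarrow> h i \<in> generate G {u}" by blast
  have u1: "u \<noteq> \<one>"
  proof
    assume "u = \<one>"
    obtain i where "i \<in> I" using \<open>I \<noteq> {}\<close> by blast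
    then have "h i \<in> generate G {\<one>}" "h i \<noteq> \<one>" using u h \<open>u = \<one>\<close> by auto
    then show False using fin by (auto simp: mem_generate_iff)
  qed
  then obtain d where d: "d \<in> D" "u \<rightarrow>\<^bsub>?\<Gamma>\<^esub> d" using D_dom u verts by blast
  \<comment> \<open>For the index assigned to the neighbour \<open>d\<close> of \<open>u\<close>,
    the subgroups of order \<open>p ?i\<close> below \<open>d\<close>, \<open>u\<close> and
    \<open>h ?i\<close> coincide; the last one is \<open>F ?i\<close>, which \<open>d\<close> was
    supposed to miss.\<close>
  let ?i = "f d"
  have i: "?i \<in> I" "p ?i dvd ord d" using f d by auto
  have "h ?i [^] ord u = \<one>"
    using u i fin by (auto simp: mem_generate_iff nat_pow_pow pow_eq_id dest!: u(2))
  then have "p ?i dvd ord u" using hT i pow_eq_id by metis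
  then have "?T ?i u = ?T ?i d" using adj d i by blast
  moreover have "?T ?i (h ?i) = ?T ?i u"
    using prime_torsion_eq[OF fin prime_p[OF i(1)] u(1) u(2)[OF i(1)]] hT i by simp
  ultimately have "F ?i = ?T ?i d" using hT i by simp
  then show False using F i d by blast
qed

end

lemma (in group) product_projections:
  assumes iso: "G \<cong> product_group I (\<lambda>i. G\<lparr>carrier := P i\<rparr>)"
    and P: "\<And>i. i \<in> I \<Longrightarrow> P i \<subseteq> carrier G"
  shows "\<exists>q. (\<forall>i\<in>I. q i \<in> hom G G \<and> (\<forall>x\<in>carrier G. q i x \<in> P i)) \<and>
           (\<forall>x\<in>carrier G. \<forall>y\<in>carrier G. (\<forall>i\<in>I. q i x = q i y) \<longrightarrow> x = y)"
proof -
  let ?R = "product_group I (\<lambda>i. G\<lparr>carrier := P i\<rparr>)"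
  obtain \<phi> where \<phi>: "\<phi> \<in> hom G ?R" "inj_on \<phi> (carrier G)"
    using iso by (auto simp: is_iso_def iso_def bij_betw_def)
  have mem: "\<phi> x \<in> (\<Pi>\<^sub>E i\<in>I. P i)" if "x \<in> carrier G" for x
    using hom_in_carrier[OF \<phi>(1) that] by simp
  have "(\<lambda>x. \<phi> x i) \<in> hom G G" if "i \<in> I" for i
    using that mem P hom_mult[OF \<phi>(1)] by (intro homI) (auto simp: PiE_iff)
  moreover have "x = y" if "x \<in> carrier G" "y \<in> carrier G" "\<forall>i\<in>I. \<phi> x i = \<phi> y i" for x y
  proof -
    have "\<phi> x = \<phi> y" using mem that by (intro PiE_ext[of _ I P]) auto
    then show ?thesis using \<phi>(2) that by (simp add: inj_on_def)
  qed
  moreover have "\<phi> x i \<in> P i" if "i \<in> I" "x \<in> carrier G" for i x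
    using mem[OF that(2)] that(1) by (simp add: PiE_iff)
  ultimately show ?thesis by (intro exI[of _ "\<lambda>i x. \<phi> x i"]) blast
qed

theorem theorem2p2:
  fixes G :: "('a, 'b) monoid_scheme"
  assumes "group G" and "finite (carrier G)" and "carrier G \<noteq> {\<one>\<^bsub>G\<^esub>}"
    and "nilpotent_group G"
    and "\<And>q Q. Factorial_Ring.prime q \<Longrightarrow> q dvd order G \<Longrightarrow> sylow_subgroup G q Q \<Longrightarrow>
           \<not> cyclic_group (G\<lparr>carrier := Q\<rparr>) \<and> \<not> generalized_quaternion_group (G\<lparr>carrier := Q\<rparr>)"
  shows "(\<forall>(p::nat) (r::nat).
            Factorial_Ring.prime p \<and> (\<exists>n::nat. order G = p ^ n) \<and>
            num_subgroups_of_order G p = r \<and>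
            (\<exists>D. total_dominating_set (proper_enhanced_power_graph G) D)
            \<longrightarrow> strong_domination_number (proper_enhanced_power_graph G) = enat (2 * r))
       \<and> (\<forall>(m::nat) (p::nat \<Rightarrow> nat) (P::nat \<Rightarrow> 'a set) (r::nat \<Rightarrow> nat).
            m \<ge> 2 \<and>
            bij_betw p {1..m} {q. Factorial_Ring.prime q \<and> q dvd order G} \<and>
            (\<forall>i \<in> {1..m}. sylow_subgroup G (p i) (P i)) \<and>
            G \<cong> product_group {1..m} (\<lambda>i. G\<lparr>carrier := P i\<rparr>) \<and>
            (\<forall>i \<in> {1..m}. r i = num_subgroups_of_order (G\<lparr>carrier := P i\<rparr>) (p i))
            \<longrightarrow> strong_domination_number (proper_enhanced_power_graph G)
                 = enat (Min (r ` {1..m}) + 1))"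
proof -
  interpret group G by (rule assms(1))
  have dom: "dominating_vertices (enhanced_power_graph G) = {\<one>\<^bsub>G\<^esub>}"
    using assms(2,4,5) by (rule dominating_enhanced_trivial)
  show ?thesis
  proof (intro conjI allI impI; elim conjE exE)
    fix p r n D
    assume "Factorial_Ring.prime p" "order G = p ^ n" "num_subgroups_of_order G p = r"
      "total_dominating_set (proper_enhanced_power_graph G) D"
    then show "strong_domination_number (proper_enhanced_power_graph G) = enat (2 * r)"
      using strong_domination_number_p_group[OF assms(2) _ _ dom] by blast
  next
    fix m :: nat and p :: "nat \<Rightarrow> nat" and P :: "nat \<Rightarrow> 'a set" and r :: "nat \<Rightarrow> nat"
    assume m: "m \<ge> 2"
      and bij: "bij_betw p {1..m} {q. Factorial_Ring.prime q \<and> q dvd order G}"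
      and syl: "\<forall>i \<in> {1..m}. sylow_subgroup G (p i) (P i)"
      and iso: "G \<cong> product_group {1..m} (\<lambda>i. G\<lparr>carrier := P i\<rparr>)"
      and r: "\<forall>i \<in> {1..m}. r i = num_subgroups_of_order (G\<lparr>carrier := P i\<rparr>) (p i)"
    have "subgroup (P i) G" if "i \<in> {1..m}" for i
      using syl that by (simp add: sylow_subgroup_def)
    then have "P i \<subseteq> carrier G" if "i \<in> {1..m}" for i
      using that subgroup.subset by blast
    from product_projections[OF iso this] obtain q
      where q: "\<forall>i\<in>{1..m}. q i \<in> hom G G \<and> (\<forall>x\<in>carrier G. q i x \<in> P i)"
        "\<forall>x\<in>carrier G. \<forall>y\<in>carrier G. (\<forall>i\<in>{1..m}. q i x = q i y) \<longrightarrow> x = y" by blast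
    interpret sylow_product G "{1..m}" p P q
      by unfold_locales (use assms(2) bij syl q in \<open>auto simp: bij_betw_def\<close>)
    have r': "r i = num_subgroups_of_order G (p i)" if "i \<in> {1..m}" for i
      using r num_subgroups_sylow that by simp
    have "Min (r ` {1..m}) \<in> r ` {1..m}" using m by (intro Min_in) auto
    then obtain i where i: "i \<in> {1..m}" "r i = Min (r ` {1..m})" by auto
    \<comment> \<open>A second prime divisor, available since \<open>m \<ge> 2\<close>, provides the
      one extra vertex in the upper bound.\<close>
    have "\<exists>j \<in> {1..m}. j \<noteq> i"
    proof (cases "i = 1")
      case True
      then show ?thesis using m by (intro bexI[of _ 2]) auto
    next
      case False
      then show ?thesis using m by (intro bexI[of _ 1]) auto
    qed
    then obtain j where j: "j \<in> {1..m}" "j \<noteq> i" by blast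
    obtain D where D: "total_dominating_set (proper_enhanced_power_graph G) D" "finite D"
      "card D \<le> num_subgroups_of_order G (p i) + 1"
      using exists_total_dominating_set[OF dom i(1) j] by blast
    show "strong_domination_number (proper_enhanced_power_graph G) = enat (Min (r ` {1..m}) + 1)"
    proof (rule strong_domination_number_eqI[OF D(1,2)])
      show "card D \<le> Min (r ` {1..m}) + 1" using D(3) r'[OF i(1)] i(2) by simp
    next
      fix E assume E: "total_dominating_set (proper_enhanced_power_graph G) E" "finite E"
      have "{1..m} \<noteq> {}" using m by simp
      then obtain k where k: "k \<in> {1..m}" "num_subgroups_of_order G (p k) < card E"
        using total_dominating_set_card_gt[OF dom _ E] by blast
      have "Min (r ` {1..m}) \<le> r k" using k(1) by (intro Min_le) auto
      then show "Min (r ` {1..m}) + 1 \<le> card E" using k(2) r'[OF k(1)] by linarith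
    qed
  qed
qed

end
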